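(* Let $\varepsilon\in\mathbb{C}$ be such that $\sin(\pi\varepsilon)\cos(2\pi\varepsilon)\neq0$. Then, for all $z_4$ with $|z_4|$ sufficiently large (and any fixed branch of $\log z_4$), \begin{align*} \frac12\Big\{&\frac{\pi^3}{\sin^2(\pi\varepsilon)\cos(2\pi\varepsilon)}\,\varphi_{345}(z_4;c(\varepsilon))\,\varphi_{345}(z_4;-c(\varepsilon))-\frac{2\pi^3}{\sin^2(\pi\varepsilon)}\,\varphi_{245}(z_4;c(\varepsilon))\,\varphi_{245}(z_4;-c(\varepsilon))\\ &+\frac{\pi^3}{\sin^2(\pi\varepsilon)\cos(2\pi\varepsilon)}\,\varphi_{124}(z_4;c(\varepsilon))\,\varphi_{124}(z_4;-c(\varepsilon))\Big\}=\frac{32}{1-16\varepsilon^2}. \end{align*}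
   Context: The functions are GKZ series (restricted to $z_1=z_2=z_3=z_5=1$) attached to the matrix with columns $(1,3,0)^t,(1,2,1)^t,(1,2,-1)^t,(1,2,0)^t,(1,1,0)^t$ and parameter $c(\varepsilon)=(1/2,\,1+\varepsilon,\,\varepsilon)^t$, resp. $-c(\varepsilon)$. Explicitly (with $1/\Gamma$ the entire reciprocal Gamma function): $$\varphi_{345}(z_4;c(\varepsilon))=z_4^{-\frac12-2\varepsilon}\sum_{m,n\ge0}\frac{z_4^{-2(m+n)}}{\Gamma(1+\varepsilon+n)\Gamma(\frac12-2\varepsilon-2m-2n)\Gamma(1+\varepsilon+m)\,m!\,n!},$$ $$\varphi_{245}(z_4;c(\varepsilon))=z_4^{-\frac12}\sum_{m,n\ge0}\frac{z_4^{-2(m+n)}}{\Gamma(1-\varepsilon+n)\Gamma(\frac12-2m-2n)\Gamma(1+\varepsilon+m)\,m!\,n!},$$ $$\varphi_{124}(z_4;c(\varepsilon))=z_4^{-\frac12+2\varepsilon}\sum_{m,n\ge0}\frac{z_4^{-2(m+n)}}{\Gamma(1-\varepsilon+n)\Gamma(\frac12+2\varepsilon-2m-2n)\Gamma(1-\varepsilon+m)\,m!\,n!},$$ and $$\varphi_{345}(z_4;-c(\varepsilon))=z_4^{\frac12+2\varepsilon}\sum_{m,n\ge0}\frac{z_4^{-2(m+n)}}{\Gamma(1-\varepsilon+n)\Gamma(\frac32+2\varepsilon-2m-2n)\Gamma(1-\varepsilon+m)\,m!\,n!},$$ $$\varphi_{245}(z_4;-c(\varepsilon))=z_4^{\frac12}\sum_{m,n\ge0}\frac{z_4^{-2(m+n)}}{\Gamma(1+\varepsilon+n)\Gamma(\frac32-2m-2n)\Gamma(1-\varepsilon+m)\,m!\,n!},$$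 $$\varphi_{124}(z_4;-c(\varepsilon))=z_4^{\frac12-2\varepsilon}\sum_{m,n\ge0}\frac{z_4^{-2(m+n)}}{\Gamma(1+\varepsilon+n)\Gamma(\frac32-2\varepsilon-2m-2n)\Gamma(1+\varepsilon+m)\,m!\,n!}.$$ *)

theory Defs
  imports "HOL-Analysis.Analysis"
begin

text \<open>
  Summands of the double series.  Here \<open>rGamma\<close> is the entire reciprocal Gamma function; all
  arguments are complex, so \<open>\<beta> - 2m - 2n\<close> does not truncate.
\<close>

definition gkz_term :: "complex \<Rightarrow> complex \<Rightarrow> complex \<Rightarrow> complex \<Rightarrow> nat \<times> nat \<Rightarrow> complex" where
  "gkz_term \<alpha> \<beta> \<gamma> z = (\<lambda>(m, n).
     rGamma (\<alpha> + of_nat n) * rGamma (\<beta> - 2 * of_nat m - 2 * of_nat n) * rGamma (\<gamma> + of_nat m)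
       / (fact m * fact n) * z powi (- 2 * int (m + n)))"

definition gkz_sum :: "complex \<Rightarrow> complex \<Rightarrow> complex \<Rightarrow> complex \<Rightarrow> complex" where
  "gkz_sum \<alpha> \<beta> \<gamma> z = (\<Sum>\<^sub>\<infinity>p\<in>UNIV. gkz_term \<alpha> \<beta> \<gamma> z p)"

text \<open>
  The functions depend on a choice of logarithm of \<open>z\<close>: the argument \<open>l\<close> is the value of the
  chosen branch at \<open>z\<close> (so \<open>exp l = z\<close>), and the power of \<open>z\<close> with exponent \<open>a\<close> is \<open>exp (a * l)\<close>.
  The suffixes \<open>pos\<close> and \<open>neg\<close> stand for the parameters \<open>c(\<epsilon>)\<close> and \<open>-c(\<epsilon>)\<close>, where
  \<open>c(\<epsilon>) = (1/2, 1 + \<epsilon>, \<epsilon>)\<close>.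
\<close>

definition phi345_pos :: "complex \<Rightarrow> complex \<Rightarrow> complex \<Rightarrow> complex" where
  "phi345_pos \<epsilon> l z = exp ((- 1/2 - 2 * \<epsilon>) * l) * gkz_sum (1 + \<epsilon>) (1/2 - 2 * \<epsilon>) (1 + \<epsilon>) z"

definition phi245_pos :: "complex \<Rightarrow> complex \<Rightarrow> complex \<Rightarrow> complex" where
  "phi245_pos \<epsilon> l z = exp ((- 1/2) * l) * gkz_sum (1 - \<epsilon>) (1/2) (1 + \<epsilon>) z"

definition phi124_pos :: "complex \<Rightarrow> complex \<Rightarrow> complex \<Rightarrow> complex" where
  "phi124_pos \<epsilon> l z = exp ((- 1/2 + 2 * \<epsilon>) * l) * gkz_sum (1 - \<epsilon>) (1/2 + 2 * \<epsilon>) (1 - \<epsilon>) z"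

definition phi345_neg :: "complex \<Rightarrow> complex \<Rightarrow> complex \<Rightarrow> complex" where
  "phi345_neg \<epsilon> l z = exp ((1/2 + 2 * \<epsilon>) * l) * gkz_sum (1 - \<epsilon>) (3/2 + 2 * \<epsilon>) (1 - \<epsilon>) z"

definition phi245_neg :: "complex \<Rightarrow> complex \<Rightarrow> complex \<Rightarrow> complex" where
  "phi245_neg \<epsilon> l z = exp ((1/2) * l) * gkz_sum (1 + \<epsilon>) (3/2) (1 - \<epsilon>) z"

definition phi124_neg :: "complex \<Rightarrow> complex \<Rightarrow> complex \<Rightarrow> complex" where
  "phi124_neg \<epsilon> l z = exp ((1/2 - 2 * \<epsilon>) * l) * gkz_sum (1 + \<epsilon>) (3/2 - 2 * \<epsilon>) (1 + \<epsilon>) z"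

text \<open>
  Unconditional summability over pairs \<open>(m, n)\<close> of all six double series (for complex terms this
  is absolute convergence).  It is stated explicitly because \<open>infsum\<close> is \<open>0\<close> on families that are
  not summable.
\<close>

definition gkz_all_summable :: "complex \<Rightarrow> complex \<Rightarrow> bool" where
  "gkz_all_summable \<epsilon> z \<longleftrightarrow>
     gkz_term (1 + \<epsilon>) (1/2 - 2 * \<epsilon>) (1 + \<epsilon>) z summable_on UNIV \<and>
     gkz_term (1 - \<epsilon>) (1/2) (1 + \<epsilon>) z summable_on UNIV \<and>
     gkz_term (1 - \<epsilon>) (1/2 + 2 * \<epsilon>) (1 - \<epsilon>) z summable_on UNIV \<and>
     gkz_term (1 - \<epsilon>) (3/2 + 2 * \<epsilon>) (1 - \<epsilon>) z summable_on UNIV \<and>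
     gkz_term (1 + \<epsilon>) (3/2) (1 - \<epsilon>) z summable_on UNIV \<and>
     gkz_term (1 + \<epsilon>) (3/2 - 2 * \<epsilon>) (1 + \<epsilon>) z summable_on UNIV"

end

theory Submission
  imports Defs
begin

text \<open>
  By the Chu-Vandermonde identity each double series is a power series in \<open>w = z\<^sup>-\<^sup>2\<close> with
  explicit coefficients, and the powers of \<open>z\<close> in front cancel in every product. By the reflection
  formula, the coefficient of \<open>w\<^sup>k\<close> on the left-hand side is, up to the factor \<open>1/2\<close>, the sum of the
  residues of one rational function with simple poles at \<open>l\<close>, \<open>\<epsilon> + l\<close> and \<open>- \<epsilon> + l\<close> for
  \<open>0 \<le> l \<le> k\<close>. For \<open>k > 0\<close> there are no other poles and the function is \<open>O(x\<^sup>-\<^sup>4)\<close>, so the sum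
  vanishes; for \<open>k = 0\<close> there is one more pole, at \<open>- 1/4\<close>, and the sum is \<open>64 / (1 - 16\<epsilon>\<^sup>2)\<close>.
\<close>

section \<open>Product identities\<close>

text \<open>The polynomial \<open>p\<close> equals its Lagrange interpolant on the nodes, and the
  sum is the coefficient of that interpolant in degree \<open>card I - 1\<close>, which exceeds
  \<open>degree p\<close>. In terms of residues, \<open>p / \<Prod> (X - x i)\<close> has none at
  infinity.\<close>

lemma sum_poly_div_prod_diff_eq_0:
  fixes p :: "'a::field poly" and x :: "'i \<Rightarrow> 'a"
  assumes fin: "finite I" and inj: "inj_on x I" and deg: "degree p + 2 \<le> card I"
  shows "(\<Sum>i\<in>I. poly p (x i) / (\<Prod>j\<in>I - {i}. x i - x j)) = 0"
proof -
  define L where "L i = (\<Prod>j\<in>I - {i}. [:- x j, 1:])" for i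
  define c where "c i = poly p (x i) / (\<Prod>j\<in>I - {i}. x i - x j)" for i
  \<comment> \<open>\<open>L i\<close> is monic and vanishes at every node except
    \<open>x i\<close>, so \<open>q\<close> is the Lagrange interpolant of \<open>p\<close>.\<close>
  define q where "q = (\<Sum>i\<in>I. smult (c i) (L i))"
  have degL: "degree (L i) = card I - 1" if "i \<in> I" for i
    unfolding L_def using that fin by (subst degree_prod_eq_sum_degree) auto
  have polyL: "poly (L i) y = (\<Prod>j\<in>I - {i}. y - x j)" for i y
    by (simp add: L_def poly_prod)
  have nz: "(\<Prod>j\<in>I - {i}. x i - x j) \<noteq> 0" if "i \<in> I" for i
    using that fin inj by (auto simp: inj_on_def)
  have "poly q (x i) = poly p (x i)" if i: "i \<in> I" for i
  proof -
    have "poly q (x i) = (\<Sum>j\<in>I. c j * poly (L j) (x i))"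
      by (simp add: q_def poly_sum)
    also have "\<dots> = c i * poly (L i) (x i)"
    proof (subst sum.remove[OF fin i])
      have "c j * poly (L j) (x i) = 0" if "j \<in> I - {i}" for j
        using that fin i by (auto simp: polyL)
      hence "(\<Sum>j\<in>I - {i}. c j * poly (L j) (x i)) = 0"
        by (intro sum.neutral ballI)
      thus "c i * poly (L i) (x i) + (\<Sum>j\<in>I - {i}. c j * poly (L j) (x i)) = c i * poly (L i) (x i)"
        by simp
    qed
    also have "\<dots> = poly p (x i)"
      using nz[OF i] by (simp add: c_def polyL)
    finally show ?thesis .
  qed
  hence "p = q"
  proof (intro poly_eqI_degree[where A = "x ` I"])
    show "degree p < card (x ` I)" using deg inj by (simp add: card_image)
    have "degree q \<le> card I - 1" unfolding q_def
      by (intro degree_sum_le fin) (use degL degree_smult_le in \<open>force intro: order_trans\<close>)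
    thus "degree q < card (x ` I)" using deg inj by (simp add: card_image)
  qed auto
  have lcL: "coeff (L i) (card I - 1) = 1" if "i \<in> I" for i
  proof -
    have "lead_coeff (L i) = 1" by (simp add: L_def lead_coeff_prod)
    thus ?thesis by (simp add: degL that)
  qed
  have "(\<Sum>i\<in>I. c i) = coeff q (card I - 1)"
    by (simp add: q_def coeff_sum lcL del: One_nat_def)
  also have "\<dots> = 0"
    using deg by (subst \<open>p = q\<close>[symmetric], intro coeff_eq_0) auto
  finally show ?thesis by (simp add: c_def)
qed

section \<open>Products of linear factors and binomial coefficients\<close>

lemma prod_lessThan_add:
  fixes f :: "nat \<Rightarrow> 'a::comm_monoid_mult"
  shows "(\<Prod>l<a + b. f l) = (\<Prod>l<a. f l) * (\<Prod>l<b. f (a + l))"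
  by (induction b) (auto simp: mult_ac)

text \<open>The product is the derivative of \<open>\<Prod> (X - l)\<close> at its root
  \<open>i\<close>: the smaller roots contribute \<open>fact i\<close>, the larger ones
  \<open>fact (k - i)\<close> with one sign each.\<close>

lemma prod_of_nat_diff:
  fixes i k :: nat
  assumes "i \<le> k"
  shows "(\<Prod>l\<in>{..k} - {i}. of_nat i - of_nat l :: 'a::field_char_0) =
           (- 1) ^ (k - i) * fact i * fact (k - i)"
  using assms
proof (induction k rule: dec_induct)
  case base
  have "(\<Prod>l\<in>{..i} - {i}. of_nat i - of_nat l :: 'a) = (\<Prod>l<i. of_nat i - of_nat l)"
    by (intro prod.cong) auto
  also have "\<dots> = (\<Prod>l<i. of_nat (Suc l))"
    by (subst prod.nat_diff_reindex[symmetric]) (auto intro!: prod.cong simp: of_nat_diff)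
  also have "\<dots> = fact i"
    by (simp add: fact_prod_Suc atLeast0LessThan)
  finally show ?case by simp
next
  case (step k)
  have "{..Suc k} - {i} = insert (Suc k) ({..k} - {i})" using step by auto
  hence "(\<Prod>l\<in>{..Suc k} - {i}. of_nat i - of_nat l :: 'a) =
      (of_nat i - of_nat (Suc k)) * ((- 1) ^ (k - i) * fact i * fact (k - i))"
    using step by simp
  also have "of_nat i - of_nat (Suc k) = - (of_nat (Suc (k - i)) :: 'a)"
    using step by (simp add: of_nat_diff)
  also have "Suc k - i = Suc (k - i)" using step by simp
  hence "- of_nat (Suc (k - i)) * ((- 1) ^ (k - i) * fact i * fact (k - i)) =
      ((- 1) ^ (Suc k - i) * fact i * fact (Suc k - i) :: 'a)"
    by (simp only: fact_Suc power_Suc of_nat_mult) (simp add: algebra_simps)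
  finally show ?case .
qed

text \<open>Each of the \<open>k + 1\<close> even indices gives a factor \<open>2 * (x - l)\<close>;
  the \<open>k\<close> odd ones stay as they are.\<close>

lemma prod_even_odd:
  fixes x :: "'a::comm_ring_1"
  shows "(\<Prod>l<2 * k + 1. 2 * x - of_nat l) =
           2 ^ (k + 1) * (\<Prod>l\<le>k. x - of_nat l) * (\<Prod>l<k. 2 * x - of_nat (2 * l + 1))"
proof (induction k)
  case (Suc k)
  have "(\<Prod>l<2 * Suc k + 1. 2 * x - of_nat l) =
      (\<Prod>l<2 * k + 1. 2 * x - of_nat l) * (2 * x - of_nat (2 * k + 1)) * (2 * (x - of_nat (Suc k)))"
    by (simp add: algebra_simps)
  also note Suc.IH
  finally show ?case by (simp only: prod.atMost_Suc prod.lessThan_Suc) (simp add: algebra_simps)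
qed auto

lemma prod_odd:
  "2 ^ i * (\<Prod>l<i. of_nat (2 * l + 1)) * fact i = (fact (2 * i) :: 'a::field_char_0)"
proof (induction i)
  case (Suc i)
  have "2 ^ Suc i * (\<Prod>l<Suc i. of_nat (2 * l + 1)) * fact (Suc i) =
      2 * of_nat (2 * i + 1) * of_nat (Suc i) * (2 ^ i * (\<Prod>l<i. of_nat (2 * l + 1)) * fact i :: 'a)"
    by (simp add: algebra_simps)
  also note Suc.IH
  also have "2 * of_nat (2 * i + 1) * of_nat (Suc i) * fact (2 * i) = (fact (2 * Suc i) :: 'a)"
    by (simp add: algebra_simps)
  finally show ?case .
qed auto

text \<open>Put \<open>x = e + i\<close>. Once factorials are cleared, the two binomial coefficients
  are the two ends of the run \<open>2x, 2x - 1, ..., 2x - 2k\<close>, and the last product on the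
  left is exactly its middle. The whole run is then split by parity.\<close>

lemma gbinomial_shift_prod:
  fixes e :: complex
  assumes "i \<le> k"
  shows "((2 * e + 2 * of_nat i) gchoose i) * ((- 2 * e + 2 * of_nat (k - i)) gchoose (k - i)) *
           (\<Prod>l\<in>{..k} - {i}. of_nat i - of_nat l) * (\<Prod>l\<le>k. 2 * e + of_nat i - of_nat l) =
         2 ^ (k + 1) * (\<Prod>l\<le>k. e + of_nat i - of_nat l) *
           (\<Prod>l<k. 2 * (e + of_nat i) - of_nat (2 * l + 1))"
proof -
  define j where "j = k - i"
  have k: "k = i + j" using assms by (simp add: j_def)
  let ?f = "\<lambda>l. 2 * (e + of_nat i) - of_nat l :: complex"
  have 1: "((2 * e + 2 * of_nat i) gchoose i) * fact i = (\<Prod>l<i. ?f l)"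
    unfolding gbinomial_mult_fact' atLeast0LessThan by (simp add: distrib_left)
  have 2: "(\<Prod>l\<le>k. 2 * e + of_nat i - of_nat l) = (\<Prod>l<Suc k. ?f (i + l))"
    unfolding lessThan_Suc_atMost by (intro prod.cong) (auto simp: algebra_simps)
  have "((- 2 * e + 2 * of_nat j) gchoose j) * fact j = (\<Prod>l<j. - 2 * e + 2 * of_nat j - of_nat l)"
    by (simp only: gbinomial_mult_fact' atLeast0LessThan)
  \<comment> \<open>In reverse order the factors are the negatives of the last \<open>j\<close>
    terms of the run; the resulting sign cancels the one from
    \<open>prod_of_nat_diff\<close>.\<close>
  also have "\<dots> = (\<Prod>l<j. - 2 * e + 2 * of_nat j - of_nat (j - Suc l))"
    by (subst prod.nat_diff_reindex[symmetric]) simp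
  also have "\<dots> = (\<Prod>l<j. - ?f (i + Suc k + l))"
    by (intro prod.cong) (auto simp: of_nat_diff k)
  also have "\<dots> = (- 1) ^ j * (\<Prod>l<j. ?f (i + Suc k + l))"
    by (subst prod_uminus) simp
  finally have 3: "((- 2 * e + 2 * of_nat j) gchoose j) * fact j = (- 1) ^ j * (\<Prod>l<j. ?f (i + Suc k + l))" .
  have "((2 * e + 2 * of_nat i) gchoose i) * ((- 2 * e + 2 * of_nat j) gchoose j) *
           (\<Prod>l\<in>{..k} - {i}. of_nat i - of_nat l) * (\<Prod>l\<le>k. 2 * e + of_nat i - of_nat l) =
        (((2 * e + 2 * of_nat i) gchoose i) * fact i) * (((- 2 * e + 2 * of_nat j) gchoose j) * fact j) *
         (- 1) ^ j * (\<Prod>l\<le>k. 2 * e + of_nat i - of_nat l)"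
    using assms by (subst prod_of_nat_diff) (auto simp: j_def)
  also have "\<dots> = ((- 1) ^ j * (- 1) ^ j) * ((\<Prod>l<i. ?f l) * (\<Prod>l<Suc k. ?f (i + l)) * (\<Prod>l<j. ?f (i + Suc k + l)))"
    unfolding 1 2 3 by (simp only: mult_ac)
  also have "(- 1) ^ j * (- 1) ^ j = (1 :: complex)"
    by (simp flip: power_add)
  also have "(\<Prod>l<i. ?f l) * (\<Prod>l<Suc k. ?f (i + l)) * (\<Prod>l<j. ?f (i + Suc k + l)) =
      (\<Prod>l<i + Suc k + j. ?f l)"
    by (simp only: prod_lessThan_add)
  also have "i + Suc k + j = 2 * k + 1" using k by simp
  also have "(\<Prod>l<2 * k + 1. ?f l) = 2 ^ (k + 1) * (\<Prod>l\<le>k. e + of_nat i - of_nat l) *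
           (\<Prod>l<k. ?f (2 * l + 1))"
    by (rule prod_even_odd)
  finally show ?thesis by (simp add: j_def)
qed

text \<open>At \<open>e = 0\<close> both sides of \<open>gbinomial_shift_prod\<close> vanish, so
  this case needs its own computation. It rests on the expression of central binomial coefficients
  by products of odd numbers.\<close>

lemma gbinomial_central_prod:
  assumes "i \<le> k"
  shows "((2 * of_nat i) gchoose i) * ((2 * of_nat (k - i)) gchoose (k - i)) *
           (\<Prod>l\<in>{..k} - {i}. of_nat i - of_nat l) =
         2 ^ k * (\<Prod>l<k. 2 * of_nat i - of_nat (2 * l + 1) :: complex)"
proof -
  define j where "j = k - i"
  have k: "k = i + j" using assms by (simp add: j_def)
  have central: "((2 * of_nat n) gchoose n) * fact n = 2 ^ n * (\<Prod>l<n. of_nat (2 * l + 1) :: complex)" for n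
  proof -
    have "((2 * of_nat n) gchoose n) = (of_nat ((2 * n) choose n) :: complex)"
      by (simp add: binomial_gbinomial)
    also have "\<dots> = fact (2 * n) / (fact n * fact n)"
      by (subst binomial_fact) (auto simp: mult_2)
    also have "\<dots> * fact n = 2 ^ n * (\<Prod>l<n. of_nat (2 * l + 1))"
      by (subst prod_odd[symmetric]) simp
    finally show ?thesis .
  qed
  \<comment> \<open>The factors turn negative at \<open>l = i\<close>; either piece is, up to sign,
    a product of consecutive odd numbers.\<close>
  have "(\<Prod>l<k. 2 * of_nat i - of_nat (2 * l + 1) :: complex) =
      (\<Prod>l<i. 2 * of_nat i - of_nat (2 * l + 1)) * (\<Prod>l<j. 2 * of_nat i - of_nat (2 * (i + l) + 1))"
    unfolding k by (rule prod_lessThan_add)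
  also have "(\<Prod>l<i. 2 * of_nat i - of_nat (2 * l + 1)) = (\<Prod>l<i. of_nat (2 * l + 1) :: complex)"
    by (subst prod.nat_diff_reindex[symmetric], intro prod.cong) (auto simp: of_nat_diff)
  also have "(\<Prod>l<j. 2 * of_nat i - of_nat (2 * (i + l) + 1)) = (\<Prod>l<j. - of_nat (2 * l + 1) :: complex)"
    by (intro prod.cong) auto
  also have "\<dots> = (- 1) ^ j * (\<Prod>l<j. of_nat (2 * l + 1))"
    by (subst prod_uminus) simp
  finally have "2 ^ k * (\<Prod>l<k. 2 * of_nat i - of_nat (2 * l + 1) :: complex) =
      (- 1) ^ j * (2 ^ i * (\<Prod>l<i. of_nat (2 * l + 1))) * (2 ^ j * (\<Prod>l<j. of_nat (2 * l + 1)))"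
    by (simp only: k power_add mult_ac)
  also have "\<dots> = (- 1) ^ j * (((2 * of_nat i) gchoose i) * fact i) * (((2 * of_nat j) gchoose j) * fact j)"
    by (simp only: central)
  finally show ?thesis
    using assms by (subst prod_of_nat_diff) (auto simp: j_def)
qed

section \<open>Reflection formula at shifted arguments\<close>

text \<open>The case \<open>k = 0\<close> is the reflection formula; for each further step the
  functional equation absorbs the new factor \<open>x - (k + 1)\<close> at the cost of a
  sign.\<close>

lemma rGamma_reflection_shift:
  fixes x :: complex
  shows "rGamma (1 + x) * rGamma (1 + of_nat k - x) * (\<Prod>l\<le>k. x - of_nat l) =
           (- 1) ^ k * sin (of_real pi * x) / of_real pi"
proof (induction k)
  case 0
  show ?case
    using rGamma_plus1[of x, symmetric] rGamma_reflection_complex[of x] by (simp add: add_ac mult_ac)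
next
  case (Suc k)
  have "rGamma (1 + of_nat (Suc k) - x) * (x - of_nat (Suc k)) = - rGamma (1 + of_nat k - x)"
    using rGamma_plus1[of "1 + of_nat k - x"] by (simp add: algebra_simps)
  moreover have "rGamma (1 + x) * rGamma (1 + of_nat (Suc k) - x) * (\<Prod>l\<le>Suc k. x - of_nat l) =
      rGamma (1 + x) * (rGamma (1 + of_nat (Suc k) - x) * (x - of_nat (Suc k))) * (\<Prod>l\<le>k. x - of_nat l)"
    by (simp only: prod.atMost_Suc mult_ac)
  ultimately have "rGamma (1 + x) * rGamma (1 + of_nat (Suc k) - x) * (\<Prod>l\<le>Suc k. x - of_nat l) =
      - (rGamma (1 + x) * rGamma (1 + of_nat k - x) * (\<Prod>l\<le>k. x - of_nat l))"
    by simp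
  thus ?case by (simp only: Suc.IH) simp
qed

lemma rGamma_half_reflection:
  fixes x :: complex
  shows "rGamma (1/2 + 2 * x) * rGamma (1/2 - 2 * x) = cos (2 * of_real pi * x) / of_real pi"
proof -
  have "sin (of_real pi * (1/2 + 2 * x)) = cos (2 * of_real pi * x)"
    using sin_cos_eq[of "of_real pi * (1/2 + 2 * x)"] by (simp add: algebra_simps)
  thus ?thesis using rGamma_reflection_complex[of "1/2 + 2 * x"] by simp
qed

text \<open>For \<open>k > 0\<close> the argument \<open>3/2 + 2x - 2k\<close> lies
  \<open>2k - 1\<close> unit steps below \<open>1/2 + 2x\<close>, so only a polynomial factor
  appears. For \<open>k = 0\<close> it lies one step above, which is the origin of the extra pole at
  \<open>- 1/4\<close>.\<close>

lemma rGamma_half_reflection_shift: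
  fixes x :: complex
  assumes "k > 0"
  shows "rGamma (1/2 - 2 * x) * rGamma (3/2 + 2 * x - 2 * of_nat k) =
           cos (2 * of_real pi * x) / of_real pi * pochhammer (3/2 + 2 * x - 2 * of_nat k) (2 * k - 1)"
proof -
  have "3/2 + 2 * x - 2 * of_nat k + of_nat (2 * k - 1) = 1/2 + 2 * x"
    using assms by (simp add: of_nat_diff field_simps)
  hence "rGamma (3/2 + 2 * x - 2 * of_nat k) =
      pochhammer (3/2 + 2 * x - 2 * of_nat k) (2 * k - 1) * rGamma (1/2 + 2 * x)"
    using pochhammer_rGamma[of "3/2 + 2 * x - 2 * of_nat k" "2 * k - 1"] by (simp only:)
  hence "rGamma (1/2 - 2 * x) * rGamma (3/2 + 2 * x - 2 * of_nat k) =
      rGamma (1/2 + 2 * x) * rGamma (1/2 - 2 * x) * pochhammer (3/2 + 2 * x - 2 * of_nat k) (2 * k - 1)"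
    by (simp only: mult_ac)
  also note rGamma_half_reflection
  finally show ?thesis .
qed

lemma sin_pi_plus_nat: "sin (of_real pi * (x + of_nat i)) = (- 1) ^ i * sin (of_real pi * x :: complex)"
proof (induction i)
  case (Suc i)
  have "sin (of_real pi * (x + of_nat i) + of_real pi) = - sin (of_real pi * (x + of_nat i) :: complex)"
    by (simp add: sin_add)
  thus ?case using Suc by (simp add: algebra_simps)
qed auto

lemma cos_2pi_plus_nat: "cos (2 * of_real pi * (x + of_nat i)) = cos (2 * of_real pi * x :: complex)"
proof -
  have *: "cos (2 * of_real pi * y) = 1 - 2 * sin (of_real pi * y) ^ 2" for y :: complex
    using cos_double_sin[of "of_real pi * y"] by (simp add: mult_ac)
  show ?thesis unfolding * sin_pi_plus_nat by (simp add: power_mult_distrib flip: power_mult)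
qed

section \<open>Power series expansions\<close>

text \<open>The sum of the coefficients over the diagonal \<open>m + n = k\<close>, already
  evaluated: the binomial coefficient is the value of a Chu-Vandermonde convolution.\<close>

definition gkz_coeff :: "complex \<Rightarrow> complex \<Rightarrow> complex \<Rightarrow> nat \<Rightarrow> complex" where
  "gkz_coeff \<alpha> \<beta> \<gamma> k =
     rGamma (\<beta> - 2 * of_nat k) * ((\<alpha> + \<gamma> + 2 * of_nat k - 2) gchoose k) *
     rGamma (\<alpha> + of_nat k) * rGamma (\<gamma> + of_nat k)"

text \<open>The two reciprocal Gamma values differ by a Pochhammer symbol. Written as a binomial
  coefficient, it has an upper entry that depends only on \<open>n + m\<close> and so is constant
  along a diagonal.\<close>

lemma rGamma_div_fact:
  fixes \<alpha> :: complex
  shows "rGamma (\<alpha> + of_nat n) / fact m =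
           rGamma (\<alpha> + of_nat (n + m)) * ((\<alpha> + of_nat (n + m) - 1) gchoose m)"
  using pochhammer_rGamma[of "\<alpha> + of_nat n" m]
  by (simp add: gbinomial_pochhammer' add_ac)

lemma powi_minus_double:
  fixes z :: "'a::field"
  shows "z powi (- 2 * int k) = (inverse z ^ 2) ^ k"
proof -
  have "z powi (- 2 * int k) = inverse (z powi int (2 * k))"
    by (simp flip: power_int_minus)
  also have "\<dots> = (inverse z ^ 2) ^ k"
    by (simp only: power_int_of_nat power_inverse power_mult)
  finally show ?thesis .
qed

lemma gkz_term_diagonal_sum:
  "(\<Sum>i\<le>k. gkz_term \<alpha> \<beta> \<gamma> z (i, k - i)) = gkz_coeff \<alpha> \<beta> \<gamma> k * (inverse z ^ 2) ^ k"
proof -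
  let ?c = "rGamma (\<beta> - 2 * of_nat k) * (inverse z ^ 2) ^ k * rGamma (\<alpha> + of_nat k) * rGamma (\<gamma> + of_nat k)"
  have "gkz_term \<alpha> \<beta> \<gamma> z (i, k - i) =
      ?c * (((\<alpha> + of_nat k - 1) gchoose i) * ((\<gamma> + of_nat k - 1) gchoose (k - i)))" if i: "i \<le> k" for i
  proof -
    \<comment> \<open>The factorial of each index is paired with the reciprocal Gamma factor of the
      other one; only this crosswise pairing makes both upper entries independent of
      \<open>i\<close>.\<close>
    have 1: "rGamma (\<alpha> + of_nat (k - i)) / fact i =
        rGamma (\<alpha> + of_nat k) * ((\<alpha> + of_nat k - 1) gchoose i)"
      using rGamma_div_fact[of \<alpha> "k - i" i] i by simp
    have 2: "rGamma (\<gamma> + of_nat i) / fact (k - i) =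
        rGamma (\<gamma> + of_nat k) * ((\<gamma> + of_nat k - 1) gchoose (k - i))"
      using rGamma_div_fact[of \<gamma> i "k - i"] i by simp
    have 3: "\<beta> - 2 * of_nat i - 2 * of_nat (k - i) = \<beta> - 2 * of_nat k"
      using i by (simp add: of_nat_diff)
    have 4: "z powi (- 2 * int (i + (k - i))) = (inverse z ^ 2) ^ k"
      using i by (simp only: powi_minus_double) simp
    have "gkz_term \<alpha> \<beta> \<gamma> z (i, k - i) = rGamma (\<beta> - 2 * of_nat k) * (inverse z ^ 2) ^ k *
        (rGamma (\<alpha> + of_nat (k - i)) / fact i) * (rGamma (\<gamma> + of_nat i) / fact (k - i))"
      unfolding gkz_term_def prod.case 3 4 by simp
    thus ?thesis unfolding 1 2 by (simp only: mult_ac)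
  qed
  hence "(\<Sum>i\<le>k. gkz_term \<alpha> \<beta> \<gamma> z (i, k - i)) =
      ?c * (\<Sum>i\<le>k. ((\<alpha> + of_nat k - 1) gchoose i) * ((\<gamma> + of_nat k - 1) gchoose (k - i)))"
    by (simp add: sum_distrib_left)
  also have "(\<Sum>i\<le>k. ((\<alpha> + of_nat k - 1) gchoose i) * ((\<gamma> + of_nat k - 1) gchoose (k - i))) =
      (\<alpha> + \<gamma> + 2 * of_nat k - 2) gchoose k"
    using gbinomial_Vandermonde[of "\<alpha> + of_nat k - 1" "\<gamma> + of_nat k - 1" k]
    by (simp add: atLeast0AtMost algebra_simps)
  finally show ?thesis by (simp add: gkz_coeff_def mult_ac)
qed

text \<open>The bijection from \<open>(m, n)\<close> to \<open>(m + n, m)\<close> turns the finite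
  diagonals into fibres, over which an unordered sum can be regrouped.\<close>

lemma has_sum_diagonals:
  fixes f :: "nat \<times> nat \<Rightarrow> 'a::{topological_comm_monoid_add, t3_space}"
  assumes "(f has_sum S) UNIV"
  shows "((\<lambda>k. \<Sum>i\<le>k. f (i, k - i)) has_sum S) UNIV"
proof (rule has_sum_SigmaD)
  show "((\<lambda>(k, i). f (i, k - i)) has_sum S) (SIGMA k:UNIV. {..k})"
    using assms
    by (subst has_sum_reindex_bij_witness[where i = "\<lambda>(m, n). (m + n, m)" and
          j = "\<lambda>(k, i). (i, k - i)" and T = UNIV and h = f and s' = S]) auto
qed (auto intro: has_sum_finite)

text \<open>The norm of a diagonal sum is at most the diagonal sum of the norms. The absolute
  convergence obtained in this way is what the Cauchy product needs.\<close>

lemma gkz_sum_power_series: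
  assumes "(\<lambda>p. norm (gkz_term \<alpha> \<beta> \<gamma> z p)) summable_on UNIV"
  shows "summable (\<lambda>k. norm (gkz_coeff \<alpha> \<beta> \<gamma> k * (inverse z ^ 2) ^ k))"
    and "(\<lambda>k. gkz_coeff \<alpha> \<beta> \<gamma> k * (inverse z ^ 2) ^ k) sums gkz_sum \<alpha> \<beta> \<gamma> z"
proof -
  have "((\<lambda>k. \<Sum>i\<le>k. gkz_term \<alpha> \<beta> \<gamma> z (i, k - i)) has_sum gkz_sum \<alpha> \<beta> \<gamma> z) UNIV"
    unfolding gkz_sum_def
    by (rule has_sum_diagonals[OF has_sum_infsum[OF abs_summable_summable[OF assms]]])
  thus "(\<lambda>k. gkz_coeff \<alpha> \<beta> \<gamma> k * (inverse z ^ 2) ^ k) sums gkz_sum \<alpha> \<beta> \<gamma> z"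
    unfolding gkz_term_diagonal_sum by (rule has_sum_imp_sums)
  have "summable (\<lambda>k. \<Sum>i\<le>k. norm (gkz_term \<alpha> \<beta> \<gamma> z (i, k - i)))"
    using has_sum_diagonals[OF has_sum_infsum[OF assms]] has_sum_imp_sums
    by (auto simp: summable_def)
  thus "summable (\<lambda>k. norm (gkz_coeff \<alpha> \<beta> \<gamma> k * (inverse z ^ 2) ^ k))"
    by (rule summable_comparison_test') (simp add: norm_sum flip: gkz_term_diagonal_sum)
qed

section \<open>Growth bounds and absolute convergence\<close>

text \<open>Consecutive values of \<open>rGamma (\<alpha> + n) * fact n\<close> have ratio
  \<open>(n + 1) / (\<alpha> + n)\<close>, which converges to 1 and is therefore bounded by some
  \<open>K\<close>.\<close>

lemma rGamma_plus_nat_bound: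
  fixes \<alpha> :: complex
  assumes "\<alpha> \<notin> \<int>\<^sub>\<le>\<^sub>0"
  shows "\<exists>C K. \<forall>n. norm (rGamma (\<alpha> + of_nat n)) * fact n \<le> C * K ^ n"
proof -
  have nz: "\<alpha> + of_nat n \<noteq> 0" for n
    using assms by (metis add_eq_0_iff2 nonpos_Ints_of_int of_int_minus of_int_of_nat_eq of_nat_0_le_iff neg_le_0_iff_le)
  have "(\<lambda>n. (of_nat n + 1) / (\<alpha> + of_nat n)) \<longlonglongrightarrow> 1"
  proof -
    have "(\<lambda>n. 1 + (1 - \<alpha>) * inverse (\<alpha> + of_nat n)) \<longlonglongrightarrow> 1 + (1 - \<alpha>) * 0"
      by (intro tendsto_add tendsto_mult tendsto_const filterlim_compose[OF tendsto_inverse_0]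
            tendsto_add_filterlim_at_infinity[OF tendsto_const] tendsto_of_nat)
    moreover have "1 + (1 - \<alpha>) * inverse (\<alpha> + of_nat n) = (of_nat n + 1) / (\<alpha> + of_nat n)" for n
      using nz[of n] by (simp add: field_simps)
    ultimately show ?thesis by simp
  qed
  hence "Bseq (\<lambda>n. (of_nat n + 1) / (\<alpha> + of_nat n))"
    by (intro convergent_imp_Bseq convergentI)
  then obtain K where K: "\<And>n. norm ((of_nat n + 1) / (\<alpha> + of_nat n)) \<le> K"
    by (auto simp: Bseq_def)
  have "norm (rGamma (\<alpha> + of_nat n)) * fact n \<le> norm (rGamma \<alpha>) * K ^ n" for n
  proof (induction n)
    case (Suc n)
    have "rGamma (\<alpha> + of_nat (Suc n)) = rGamma (\<alpha> + of_nat n) / (\<alpha> + of_nat n)"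
      using rGamma_plus1[of "\<alpha> + of_nat n"] nz[of n] by (simp add: field_simps)
    moreover have "norm (of_nat n + 1 :: complex) = real n + 1"
      by (metis norm_of_nat of_nat_Suc add.commute)
    ultimately have "norm (rGamma (\<alpha> + of_nat (Suc n))) * fact (Suc n) =
        (norm (rGamma (\<alpha> + of_nat n)) * fact n) * norm ((of_nat n + 1) / (\<alpha> + of_nat n))"
      by (simp add: norm_divide)
    also have "\<dots> \<le> (norm (rGamma \<alpha>) * K ^ n) * K"
      by (intro mult_mono Suc.IH K) (use order_trans[OF norm_ge_zero K] in auto)
    finally show ?case by (simp add: mult_ac)
  qed auto
  thus ?thesis by blast
qed

text \<open>Each step down multiplies by \<open>\<beta> - (n + 1)\<close>, whose norm is at most
  \<open>(norm \<beta> + 1) * (n + 1)\<close>.\<close>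

lemma rGamma_minus_nat_bound:
  fixes \<beta> :: complex
  shows "norm (rGamma (\<beta> - of_nat n)) \<le> norm (rGamma \<beta>) * (norm \<beta> + 1) ^ n * fact n"
proof (induction n)
  case (Suc n)
  have "norm (rGamma (\<beta> - of_nat (Suc n))) = norm (\<beta> - of_nat (Suc n)) * norm (rGamma (\<beta> - of_nat n))"
    using rGamma_plus1[of "\<beta> - of_nat (Suc n)"] by (simp flip: norm_mult)
  also have "\<dots> \<le> ((norm \<beta> + 1) * real (Suc n)) * (norm (rGamma \<beta>) * (norm \<beta> + 1) ^ n * fact n)"
  proof -
    have "norm (\<beta> - of_nat (Suc n)) \<le> norm \<beta> + real (Suc n)"
      by (metis norm_triangle_ineq4 norm_of_nat)
    moreover have "norm \<beta> * 1 \<le> norm \<beta> * real (Suc n)"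
      by (intro mult_left_mono) auto
    ultimately have "norm (\<beta> - of_nat (Suc n)) \<le> (norm \<beta> + 1) * real (Suc n)"
      unfolding distrib_right mult_1_left mult_1_right by linarith
    thus ?thesis
      by (intro mult_mono Suc.IH) auto
  qed
  finally show ?case by (simp add: mult_ac)
qed auto

lemma fact_add_le: "(fact (m + n) :: real) \<le> 2 ^ (m + n) * (fact m * fact n)"
proof -
  have "real ((m + n) choose m) \<le> 2 ^ (m + n)"
    using binomial_le_pow2[of "m + n" m] by (metis of_nat_le_iff of_nat_numeral of_nat_power)
  thus ?thesis
    by (subst (asm) binomial_fact) (auto simp: field_simps)
qed

text \<open>Up to geometric factors, the reciprocal Gamma value at \<open>\<beta> - 2m - 2n\<close>
  grows at most like the square of \<open>fact m * fact n\<close>. One copy is cancelled by the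
  denominator, the other by the decay of the two remaining Gamma factors, and a product of two
  geometric sequences is left.\<close>

lemma gkz_term_summable:
  assumes "\<alpha> \<notin> \<int>\<^sub>\<le>\<^sub>0" "\<gamma> \<notin> \<int>\<^sub>\<le>\<^sub>0"
  shows "\<forall>\<^sub>F z in at_infinity. (\<lambda>p. norm (gkz_term \<alpha> \<beta> \<gamma> z p)) summable_on UNIV"
proof -
  obtain C K where CK: "\<And>n. norm (rGamma (\<alpha> + of_nat n)) * fact n \<le> C * K ^ n"
    using rGamma_plus_nat_bound[OF assms(1)] by blast
  obtain D L where DL: "\<And>n. norm (rGamma (\<gamma> + of_nat n)) * fact n \<le> D * L ^ n"
    using rGamma_plus_nat_bound[OF assms(2)] by blast
  define B where "B = (norm \<beta> + 1) ^ 2"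
  define E where "E = norm (rGamma \<beta>)"
  have bound: "norm (gkz_term \<alpha> \<beta> \<gamma> z (m, n)) \<le>
      E * C * D * (((16 * B * L * norm (inverse z ^ 2)) ^ m) * ((16 * B * K * norm (inverse z ^ 2)) ^ n))" for z m n
  proof -
    \<comment> \<open>The base 16 is \<open>4 * 2 * 2\<close>: halving \<open>2 * (m + n)\<close>
      costs \<open>4 ^ (m + n)\<close>, and splitting each of the two halves into \<open>m\<close>
      and \<open>n\<close> costs \<open>2 ^ (m + n)\<close>.\<close>
    have F: "fact (2 * (m + n)) \<le> 16 ^ (m + n) * ((fact m * fact n) * (fact m * fact n) :: real)"
    proof -
      have "fact (2 * (m + n)) \<le> 2 ^ (2 * (m + n)) * (fact (m + n) * fact (m + n) :: real)"
        using fact_add_le[of "m + n" "m + n"] by (simp only: mult_2)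
      also have "\<dots> \<le> 2 ^ (2 * (m + n)) * ((2 ^ (m + n) * (fact m * fact n)) * (2 ^ (m + n) * (fact m * fact n)))"
        by (intro mult_mono fact_add_le) auto
      also have "\<dots> = (2 ^ (2 * (m + n)) * 2 ^ (m + n) * 2 ^ (m + n)) * ((fact m * fact n) * (fact m * fact n))"
        by (simp only: mult_ac)
      also have "2 ^ (2 * (m + n)) * 2 ^ (m + n) * 2 ^ (m + n) = (16 ^ (m + n) :: real)"
      proof -
        have "2 ^ (2 * (m + n)) * 2 ^ (m + n) * 2 ^ (m + n) = (2 :: real) ^ (4 * (m + n))"
          by (simp only: power_add[symmetric]) (rule arg_cong[where f = "power 2"], simp)
        thus ?thesis by (simp only: power_mult) simp
      qed
      finally show ?thesis .
    qed
    have "norm (rGamma (\<beta> - 2 * of_nat m - 2 * of_nat n)) \<le> E * B ^ (m + n) * fact (2 * (m + n))"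
    proof -
      have "\<beta> - 2 * of_nat m - 2 * of_nat n = \<beta> - of_nat (2 * (m + n))" by simp
      thus ?thesis
        using rGamma_minus_nat_bound[of \<beta> "2 * (m + n)"]
        by (simp only: E_def B_def power_mult)
    qed
    also have "\<dots> \<le> E * B ^ (m + n) * (16 ^ (m + n) * ((fact m * fact n) * (fact m * fact n)))"
      by (intro mult_left_mono F) (auto simp: E_def B_def)
    finally have R: "norm (rGamma (\<beta> - 2 * of_nat m - 2 * of_nat n)) \<le>
        E * (16 * B) ^ (m + n) * ((fact m * fact n) * (fact m * fact n))"
      by (simp only: power_mult_distrib mult_ac)
    have P: "norm (z powi (- 2 * int (m + n))) = norm (inverse z ^ 2) ^ (m + n)"
      by (simp only: powi_minus_double norm_power)
    have "norm (gkz_term \<alpha> \<beta> \<gamma> z (m, n)) =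
        norm (rGamma (\<beta> - 2 * of_nat m - 2 * of_nat n)) *
          (norm (rGamma (\<alpha> + of_nat n)) * norm (rGamma (\<gamma> + of_nat m)) / (fact m * fact n) *
           norm (inverse z ^ 2) ^ (m + n))"
      unfolding gkz_term_def prod.case norm_mult norm_divide P by simp
    also have "\<dots> \<le> (E * (16 * B) ^ (m + n) * ((fact m * fact n) * (fact m * fact n))) *
          (norm (rGamma (\<alpha> + of_nat n)) * norm (rGamma (\<gamma> + of_nat m)) / (fact m * fact n) *
           norm (inverse z ^ 2) ^ (m + n))"
      by (intro mult_right_mono R) auto
    also have "\<dots> = (E * (16 * B) ^ (m + n) * norm (inverse z ^ 2) ^ (m + n)) *
        ((norm (rGamma (\<alpha> + of_nat n)) * fact n) * (norm (rGamma (\<gamma> + of_nat m)) * fact m))"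
    proof -
      have "F * F * (G / F * W) = W * (G * F)" if "F \<noteq> 0" for F G W :: real
        using that by simp
      from this[of "fact m * fact n"] show ?thesis by (simp add: mult_ac)
    qed
    also have "\<dots> \<le> (E * (16 * B) ^ (m + n) * norm (inverse z ^ 2) ^ (m + n)) * ((C * K ^ n) * (D * L ^ m))"
      by (intro mult_left_mono mult_mono CK DL order_trans[OF _ CK]) (auto simp: E_def B_def)
    also have "\<dots> = E * C * D * (((16 * B * L * norm (inverse z ^ 2)) ^ m) * ((16 * B * K * norm (inverse z ^ 2)) ^ n))"
      by (simp only: power_add power_mult_distrib mult_ac)
    finally show ?thesis .
  qed
  \<comment> \<open>Both geometric ratios contain \<open>norm (inverse z ^ 2)\<close>, so they drop
    below 1 for large \<open>z\<close>, whatever the constants.\<close>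
  have lim: "((\<lambda>z::complex. 16 * B * M * norm (inverse z ^ 2)) \<longlongrightarrow> 16 * B * M * norm (0 ^ 2 :: complex)) at_infinity" for M
    by (intro tendsto_intros tendsto_inverse_0)
  have "\<forall>\<^sub>F z in at_infinity. norm (16 * B * M * norm (inverse z ^ 2 :: complex)) < 1" for M
    using order_tendstoD(2)[OF tendsto_norm[OF lim[of M]], of 1] by simp
  from this[of K] this[of L] show ?thesis
  proof eventually_elim
    case (elim z)
    define a where "a = 16 * B * L * norm (inverse z ^ 2)"
    define b where "b = 16 * B * K * norm (inverse z ^ 2)"
    have geo: "(\<lambda>n. norm (x ^ n)) summable_on UNIV" if "norm x < 1" for x :: real
      by (rule norm_summable_imp_summable_on)
         (use that in \<open>simp add: norm_power power_abs summable_geometric\<close>)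
    have "(\<lambda>p. norm (case p of (m, n) \<Rightarrow> a ^ m * b ^ n)) summable_on UNIV \<times> UNIV"
    proof (rule summable_on_SigmaI)
      show "((\<lambda>n. norm (case (m, n) of (m, n) \<Rightarrow> a ^ m * b ^ n)) has_sum
              norm (a ^ m) * (\<Sum>\<^sub>\<infinity>n. norm (b ^ n))) UNIV" for m
        unfolding prod.case norm_mult using elim
        by (intro has_sum_cmult_right has_sum_infsum geo) (simp add: b_def)
      show "(\<lambda>m. norm (a ^ m) * (\<Sum>\<^sub>\<infinity>n. norm (b ^ n))) summable_on UNIV"
        using elim by (intro summable_on_cmult_left geo) (simp add: a_def)
    qed auto
    hence ab: "(\<lambda>p. norm (E * C * D) * norm (case p of (m, n) \<Rightarrow> a ^ m * b ^ n)) summable_on UNIV"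
      by (intro summable_on_cmult_right) simp
    show ?case
    proof (rule Infinite_Sum.abs_summable_on_comparison_test'[OF ab])
      fix p :: "nat \<times> nat"
      obtain m n where p: "p = (m, n)" by (cases p)
      show "norm (gkz_term \<alpha> \<beta> \<gamma> z p) \<le> norm (E * C * D) * norm (case p of (m, n) \<Rightarrow> a ^ m * b ^ n)"
        unfolding p prod.case
        by (rule order_trans[OF bound order_trans[OF abs_ge_self]])
           (simp add: abs_mult norm_mult flip: a_def b_def)
    qed
  qed
qed

section \<open>Coefficients of the products as residues\<close>

text \<open>
  Up to the prefactors, \<open>poly (node_poly k) x / \<Prod> (x - l) (x - l - \<epsilon>) (x - l + \<epsilon>)\<close>, with \<open>l\<close>
  running over \<open>0, \<dots>, k\<close>, is what the product of a coefficient of a series for \<open>c(\<epsilon>)\<close> and one for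
  \<open>-c(\<epsilon>)\<close> becomes after the reflection formula; the actual products are its residues.
\<close>

definition node_poly :: "nat \<Rightarrow> complex poly" where
  "node_poly k = [:2 ^ (k + 1):] * (\<Prod>l<k. [:- of_nat (2 * l + 1), 2:]) *
     (\<Prod>l<2 * k - 1. [:3/2 - 2 * of_nat k + of_nat l, 2:])"

lemma poly_node_poly:
  "poly (node_poly k) x = 2 ^ (k + 1) * (\<Prod>l<k. 2 * x - of_nat (2 * l + 1)) *
     pochhammer (3/2 + 2 * x - 2 * of_nat k) (2 * k - 1)"
  unfolding node_poly_def pochhammer_prod atLeast0LessThan
  by (simp add: poly_prod algebra_simps)

text \<open>There are \<open>k\<close> and \<open>2k - 1\<close> linear factors. Against a
  denominator of degree \<open>3k + 3\<close> this is the decay of order \<open>- 4\<close>.\<close>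

lemma degree_node_poly:
  assumes "k > 0"
  shows "degree (node_poly k) \<le> 3 * k - 1"
proof -
  have 1: "degree (\<Prod>l<k. [:- of_nat (2 * l + 1), 2 :: complex:]) \<le> k"
    by (rule order_trans[OF degree_prod_sum_le]) auto
  have 2: "degree (\<Prod>l<2 * k - 1. [:3/2 - 2 * of_nat k + of_nat l, 2 :: complex:]) \<le> 2 * k - 1"
    by (rule order_trans[OF degree_prod_sum_le]) auto
  have "degree (node_poly k) \<le> 0 + k + (2 * k - 1)"
    unfolding node_poly_def
    by (intro order_trans[OF degree_mult_le] add_mono 1 2) simp
  thus ?thesis using assms by simp
qed

lemma prod_shift_nonzero:
  fixes \<epsilon> :: complex
  assumes "\<epsilon> \<notin> \<int>"
  shows "(\<Prod>l\<le>k. \<epsilon> + of_nat i - of_nat l) \<noteq> 0"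
proof -
  have "\<epsilon> + of_nat i - of_nat l \<noteq> 0" for l
  proof
    assume "\<epsilon> + of_nat i - of_nat l = 0"
    hence "\<epsilon> = of_int (int l - int i)" by (simp add: algebra_simps)
    thus False using assms by (metis Ints_of_int)
  qed
  thus ?thesis by simp
qed

lemma rGamma_reflection_nat_shifts:
  fixes \<epsilon> :: complex
  assumes "\<epsilon> \<notin> \<int>"
  shows "rGamma (1 + (\<epsilon> + of_nat i)) * rGamma (1 + of_nat k - (\<epsilon> + of_nat i)) =
           (- 1) ^ (k + i) * sin (of_real pi * \<epsilon>) / (of_real pi * (\<Prod>l\<le>k. \<epsilon> + of_nat i - of_nat l))"
proof -
  let ?Q = "\<Prod>l\<le>k. \<epsilon> + of_nat i - of_nat l"
  have "rGamma (1 + (\<epsilon> + of_nat i)) * rGamma (1 + of_nat k - (\<epsilon> + of_nat i)) * ?Q =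
      (- 1) ^ (k + i) * sin (of_real pi * \<epsilon>) / of_real pi"
    unfolding rGamma_reflection_shift sin_pi_plus_nat by (simp add: power_add)
  from eq_divide_imp[OF prod_shift_nonzero[OF assms] this] show ?thesis
    by (simp only: divide_divide_eq_left)
qed

text \<open>The right-hand side is the residue at the node \<open>\<epsilon> + i\<close>: the three
  products are its differences to the other nodes of its own chain and to the nodes of the chains
  starting at \<open>0\<close> and \<open>- \<epsilon>\<close>. The prefactor cancels the sines, the
  cosine and the powers of pi from the reflection formulas.\<close>

lemma gkz_coeff_product_shifted:
  fixes \<epsilon> :: complex
  assumes i: "i \<le> k" and k: "k > 0" and \<epsilon>: "2 * \<epsilon> \<notin> \<int>"
    and s: "sin (of_real pi * \<epsilon>) \<noteq> 0" and c: "cos (2 * of_real pi * \<epsilon>) \<noteq> 0"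
  shows "of_real pi ^ 3 / (sin (of_real pi * \<epsilon>) ^ 2 * cos (2 * of_real pi * \<epsilon>)) *
           (gkz_coeff (1 + \<epsilon>) (1/2 - 2 * \<epsilon>) (1 + \<epsilon>) i * gkz_coeff (1 - \<epsilon>) (3/2 + 2 * \<epsilon>) (1 - \<epsilon>) (k - i)) =
         poly (node_poly k) (\<epsilon> + of_nat i) /
           ((\<Prod>l\<in>{..k} - {i}. of_nat i - of_nat l) * (\<Prod>l\<le>k. \<epsilon> + of_nat i - of_nat l) *
            (\<Prod>l\<le>k. 2 * \<epsilon> + of_nat i - of_nat l))"
proof -
  define x where "x = \<epsilon> + of_nat i"
  define D where "D = (\<Prod>l\<in>{..k} - {i}. of_nat i - of_nat l :: complex)"
  define Q where "Q = (\<Prod>l\<le>k. x - of_nat l)"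
  define R where "R = (\<Prod>l\<le>k. 2 * \<epsilon> + of_nat i - of_nat l)"
  define A where "A = ((2 * \<epsilon> + 2 * of_nat i) gchoose i)"
  define B where "B = ((- 2 * \<epsilon> + 2 * of_nat (k - i)) gchoose (k - i))"
  define p where "p = pochhammer (3/2 + 2 * x - 2 * of_nat k) (2 * k - 1)"
  define O' where "O' = (\<Prod>l<k. 2 * x - of_nat (2 * l + 1))"
  define s' where "s' = sin (of_real pi * \<epsilon>)"
  define c' where "c' = cos (2 * of_real pi * \<epsilon>)"
  define P where "P = (of_real pi :: complex)"
  have \<epsilon>': "\<epsilon> \<notin> \<int>" using \<epsilon> by (metis Ints_mult Ints_numeral)
  have R0: "R \<noteq> 0" using prod_shift_nonzero[OF \<epsilon>] by (simp only: R_def) simp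
  have Q0: "Q \<noteq> 0" using prod_shift_nonzero[OF \<epsilon>'] by (simp only: Q_def x_def) simp
  have D0: "D \<noteq> 0" by (simp add: D_def)
  have P0: "P \<noteq> 0" by (simp add: P_def)
  have s0: "s' \<noteq> 0" and c0: "c' \<noteq> 0" using s c by (simp_all only: s'_def c'_def not_False_eq_True)
  have AB: "A * B * D * R = 2 ^ (k + 1) * Q * O'"
    using gbinomial_shift_prod[OF i, of \<epsilon>] by (simp only: A_def B_def D_def R_def Q_def O'_def x_def)
  \<comment> \<open>Squaring removes the sign \<open>(- 1) ^ (k + i)\<close>.\<close>
  have G: "(rGamma (1 + x) * rGamma (1 + of_nat k - x)) ^ 2 = s' ^ 2 / (P * Q) ^ 2"
    using rGamma_reflection_nat_shifts[OF \<epsilon>', of i k]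
    by (simp add: Q_def x_def s'_def P_def power_divide power_mult_distrib flip: power_mult)
  have H: "rGamma (1/2 - 2 * x) * rGamma (3/2 + 2 * x - 2 * of_nat k) = c' / P * p"
    using rGamma_half_reflection_shift[OF k, of x]
    by (simp only: p_def c'_def P_def cos_2pi_plus_nat x_def)
  have c1: "gkz_coeff (1 + \<epsilon>) (1/2 - 2 * \<epsilon>) (1 + \<epsilon>) i = rGamma (1/2 - 2 * x) * A * rGamma (1 + x) ^ 2"
    by (simp add: gkz_coeff_def A_def x_def power2_eq_square algebra_simps)
  have ki: "of_nat (k - i) = (of_nat k - of_nat i :: complex)" using i by (simp add: of_nat_diff)
  have c2: "gkz_coeff (1 - \<epsilon>) (3/2 + 2 * \<epsilon>) (1 - \<epsilon>) (k - i) =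
      rGamma (3/2 + 2 * x - 2 * of_nat k) * B * rGamma (1 + of_nat k - x) ^ 2"
    by (simp add: gkz_coeff_def B_def x_def power2_eq_square ki algebra_simps)
  have "P ^ 3 / (s' ^ 2 * c') * (gkz_coeff (1 + \<epsilon>) (1/2 - 2 * \<epsilon>) (1 + \<epsilon>) i * gkz_coeff (1 - \<epsilon>) (3/2 + 2 * \<epsilon>) (1 - \<epsilon>) (k - i))
      = P ^ 3 / (s' ^ 2 * c') * (rGamma (1/2 - 2 * x) * rGamma (3/2 + 2 * x - 2 * of_nat k)) * (A * B) *
        (rGamma (1 + x) * rGamma (1 + of_nat k - x)) ^ 2"
    unfolding c1 c2 power_mult_distrib by (simp only: mult_ac)
  also have "\<dots> = P ^ 3 / (s' ^ 2 * c') * (c' / P * p) * (A * B) * (s' ^ 2 / (P * Q) ^ 2)"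
    unfolding H G ..
  also have "\<dots> = p * (A * B) / Q ^ 2"
    using s0 c0 P0 Q0 by (simp add: field_simps power2_eq_square power3_eq_cube)
  \<comment> \<open>The \<open>Q\<close> in this numerator cancels one of the two in the
    denominator, so that the chain starting at \<open>0\<close> enters only to first order.\<close>
  also have "A * B = 2 ^ (k + 1) * Q * O' / (D * R)"
    using AB D0 R0 by (simp add: field_simps)
  also have "p * (2 ^ (k + 1) * Q * O' / (D * R)) / Q ^ 2 = 2 ^ (k + 1) * O' * p / (D * Q * R)"
    using D0 R0 Q0 by (simp add: field_simps power2_eq_square)
  finally show ?thesis
    unfolding poly_node_poly by (simp only: P_def s'_def c'_def p_def O'_def D_def Q_def R_def x_def)
qed

text \<open>This is the residue at the node \<open>i\<close>. The Gamma factors pair up at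
  \<open>\<epsilon> + i\<close> and \<open>- \<epsilon> + i\<close>, and their sines have opposite
  signs, which explains the leading minus; the factor 2 raises the \<open>2 ^ k\<close> of
  \<open>gbinomial_central_prod\<close> to the \<open>2 ^ (k + 1)\<close> of
  \<open>node_poly\<close>.\<close>

lemma gkz_coeff_product_central:
  fixes \<epsilon> :: complex
  assumes i: "i \<le> k" and k: "k > 0" and s: "sin (of_real pi * \<epsilon>) \<noteq> 0" and \<epsilon>: "\<epsilon> \<notin> \<int>"
  shows "- (2 * of_real pi ^ 3 / sin (of_real pi * \<epsilon>) ^ 2 *
           (gkz_coeff (1 - \<epsilon>) (1/2) (1 + \<epsilon>) i * gkz_coeff (1 + \<epsilon>) (3/2) (1 - \<epsilon>) (k - i))) =
         poly (node_poly k) (of_nat i) /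
           ((\<Prod>l\<in>{..k} - {i}. of_nat i - of_nat l) * (\<Prod>l\<le>k. \<epsilon> + of_nat i - of_nat l) *
            (\<Prod>l\<le>k. - \<epsilon> + of_nat i - of_nat l))"
proof -
  define x where "x = (of_nat i :: complex)"
  define D where "D = (\<Prod>l\<in>{..k} - {i}. of_nat i - of_nat l :: complex)"
  define Q where "Q = (\<Prod>l\<le>k. \<epsilon> + x - of_nat l)"
  define R where "R = (\<Prod>l\<le>k. - \<epsilon> + x - of_nat l)"
  define A where "A = ((2 * of_nat i) gchoose i :: complex)"
  define B where "B = ((2 * of_nat (k - i)) gchoose (k - i) :: complex)"
  define p where "p = pochhammer (3/2 + 2 * x - 2 * of_nat k) (2 * k - 1)"
  define O' where "O' = (\<Prod>l<k. 2 * x - of_nat (2 * l + 1))"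
  define s' where "s' = sin (of_real pi * \<epsilon>)"
  define P where "P = (of_real pi :: complex)"
  have \<epsilon>': "- \<epsilon> \<notin> \<int>" using \<epsilon> by (metis Ints_minus minus_minus)
  have R0: "R \<noteq> 0" using prod_shift_nonzero[OF \<epsilon>'] by (simp only: R_def x_def) simp
  have Q0: "Q \<noteq> 0" using prod_shift_nonzero[OF \<epsilon>] by (simp only: Q_def x_def) simp
  have D0: "D \<noteq> 0" by (simp add: D_def)
  have P0: "P \<noteq> 0" by (simp add: P_def)
  have s0: "s' \<noteq> 0" using s by (simp only: s'_def not_False_eq_True)
  have AB: "A * B * D = 2 ^ k * O'"
    using gbinomial_central_prod[OF i] by (simp only: A_def B_def D_def O'_def x_def)
  have G: "rGamma (1 + (\<epsilon> + x)) * rGamma (1 + of_nat k - (\<epsilon> + x)) = (- 1) ^ (k + i) * s' / (P * Q)"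
    using rGamma_reflection_nat_shifts[OF \<epsilon>, of i k] by (simp only: Q_def x_def s'_def P_def)
  have G': "rGamma (1 + (- \<epsilon> + x)) * rGamma (1 + of_nat k - (- \<epsilon> + x)) = - ((- 1) ^ (k + i) * s' / (P * R))"
    using rGamma_reflection_nat_shifts[OF \<epsilon>', of i k] by (simp add: R_def x_def s'_def P_def)
  have sgn: "(- 1) ^ (k + i) * (- 1) ^ (k + i) = (1 :: complex)"
    by (simp flip: power_add)
  \<comment> \<open>The cosine is 1 at integers, hence no cosine in the prefactor.\<close>
  have H: "rGamma (1/2 - 2 * x) * rGamma (3/2 + 2 * x - 2 * of_nat k) = 1 / P * p"
    using rGamma_half_reflection_shift[OF k, of x] cos_2pi_plus_nat[of 0 i]
    by (simp add: p_def P_def x_def)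
  have ki: "of_nat (k - i) = (of_nat k - of_nat i :: complex)" using i by (simp add: of_nat_diff)
  have c1: "gkz_coeff (1 - \<epsilon>) (1/2) (1 + \<epsilon>) i =
      rGamma (1/2 - 2 * x) * A * rGamma (1 + (- \<epsilon> + x)) * rGamma (1 + (\<epsilon> + x))"
    by (simp add: gkz_coeff_def A_def x_def algebra_simps)
  have c2: "gkz_coeff (1 + \<epsilon>) (3/2) (1 - \<epsilon>) (k - i) =
      rGamma (3/2 + 2 * x - 2 * of_nat k) * B * rGamma (1 + of_nat k - (- \<epsilon> + x)) * rGamma (1 + of_nat k - (\<epsilon> + x))"
    by (simp add: gkz_coeff_def B_def x_def ki algebra_simps)
  have "- (2 * P ^ 3 / s' ^ 2 * (gkz_coeff (1 - \<epsilon>) (1/2) (1 + \<epsilon>) i * gkz_coeff (1 + \<epsilon>) (3/2) (1 - \<epsilon>) (k - i)))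
      = - (2 * P ^ 3 / s' ^ 2 * (rGamma (1/2 - 2 * x) * rGamma (3/2 + 2 * x - 2 * of_nat k)) * (A * B) *
        ((rGamma (1 + (\<epsilon> + x)) * rGamma (1 + of_nat k - (\<epsilon> + x))) *
         (rGamma (1 + (- \<epsilon> + x)) * rGamma (1 + of_nat k - (- \<epsilon> + x)))))"
    unfolding c1 c2 by (simp only: mult_ac)
  also have "(rGamma (1 + (\<epsilon> + x)) * rGamma (1 + of_nat k - (\<epsilon> + x))) *
         (rGamma (1 + (- \<epsilon> + x)) * rGamma (1 + of_nat k - (- \<epsilon> + x))) =
      - ((- 1) ^ (k + i) * (- 1) ^ (k + i) * s' ^ 2 / (P ^ 2 * Q * R))"
    unfolding G G' by (simp only: power2_eq_square times_divide_times_eq mult_minus_right mult_ac)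
  also have "\<dots> = - (s' ^ 2 / (P ^ 2 * Q * R))"
    by (simp only: sgn mult_1_left)
  also have "- (2 * P ^ 3 / s' ^ 2 * (rGamma (1/2 - 2 * x) * rGamma (3/2 + 2 * x - 2 * of_nat k)) * (A * B) *
       - (s' ^ 2 / (P ^ 2 * Q * R))) = 2 * p * (A * B) / (Q * R)"
    unfolding H using s0 P0 Q0 R0
    by (simp add: field_simps power2_eq_square power3_eq_cube)
  also have "A * B = 2 ^ k * O' / D"
    using AB D0 by (simp add: field_simps)
  also have "2 * p * (2 ^ k * O' / D) / (Q * R) = 2 ^ (k + 1) * O' * p / (D * Q * R)"
    by (simp add: mult_ac)
  finally show ?thesis
    unfolding poly_node_poly by (simp only: P_def s'_def p_def O'_def D_def Q_def R_def x_def)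
qed

section \<open>Vanishing of the sum of residues\<close>

text \<open>The interpolation identity is applied to the \<open>3 * (k + 1)\<close> nodes
  \<open>t * \<epsilon> + i\<close> with \<open>t\<close> in \<open>{-1, 0, 1}\<close>; the degree
  bound is two less than their number.\<close>

lemma sum_over_three_chains:
  fixes \<epsilon> :: complex and p :: "complex poly"
  assumes deg: "degree p \<le> 3 * k + 1" and \<epsilon>: "2 * \<epsilon> \<notin> \<int>"
  shows "(\<Sum>i\<le>k. poly p (\<epsilon> + of_nat i) /
            ((\<Prod>l\<in>{..k} - {i}. of_nat i - of_nat l) * (\<Prod>l\<le>k. \<epsilon> + of_nat i - of_nat l) *
             (\<Prod>l\<le>k. 2 * \<epsilon> + of_nat i - of_nat l))) +
         (\<Sum>i\<le>k. poly p (of_nat i) /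
            ((\<Prod>l\<in>{..k} - {i}. of_nat i - of_nat l) * (\<Prod>l\<le>k. \<epsilon> + of_nat i - of_nat l) *
             (\<Prod>l\<le>k. - \<epsilon> + of_nat i - of_nat l))) +
         (\<Sum>i\<le>k. poly p (- \<epsilon> + of_nat i) /
            ((\<Prod>l\<in>{..k} - {i}. of_nat i - of_nat l) * (\<Prod>l\<le>k. - \<epsilon> + of_nat i - of_nat l) *
             (\<Prod>l\<le>k. 2 * (- \<epsilon>) + of_nat i - of_nat l))) = 0"
proof -
  define T :: "int set" where "T = {-1, 0, 1}"
  define x where "x = (\<lambda>(t, i). of_int t * \<epsilon> + of_nat i :: complex)"
  have inj: "inj_on x (T \<times> {..k})"
  proof (rule inj_onI, clarify)
    fix t u :: int and i j :: nat
    assume t: "t \<in> T" and u: "u \<in> T" and eq: "x (t, i) = x (u, j)"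
    hence *: "of_int (t - u) * \<epsilon> = of_int (int j - int i)"
      by (simp add: x_def algebra_simps)
    \<comment> \<open>If nodes of two chains coincide, then \<open>\<epsilon>\<close> or
      \<open>2 * \<epsilon>\<close> is an integer up to sign, and in each case so is
      \<open>2 * \<epsilon>\<close>.\<close>
    have "t = u"
    proof (rule ccontr)
      assume "t \<noteq> u"
      then consider "t - u = 1" | "t - u = -1" | "t - u = 2" | "t - u = -2"
        using t u by (auto simp: T_def)
      then have "2 * \<epsilon> \<in> \<int>"
      proof cases
        case 1
        with * have "\<epsilon> = of_int (int j - int i)" by simp
        thus ?thesis by (metis Ints_mult Ints_numeral Ints_of_int)
      next
        case 2
        with * have "- \<epsilon> = of_int (int j - int i)" by simp
        hence "\<epsilon> = - of_int (int j - int i)" by (metis minus_minus)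
        thus ?thesis by (metis Ints_mult Ints_numeral Ints_of_int Ints_minus)
      next
        case 3
        with * show ?thesis by (metis Ints_of_int of_int_numeral)
      next
        case 4
        with * have "- (2 * \<epsilon>) = of_int (int j - int i)" by simp
        thus ?thesis by (metis Ints_of_int Ints_minus minus_minus)
      qed
      thus False using \<epsilon> by contradiction
    qed
    thus "t = u \<and> i = j" using * by simp
  qed
  have prods: "(\<Prod>q\<in>T \<times> {..k} - {(t, i)}. x (t, i) - x q) =
      (\<Prod>l\<in>{..k} - {i}. of_nat i - of_nat l) *
      (\<Prod>u\<in>T - {t}. \<Prod>l\<le>k. of_int (t - u) * \<epsilon> + of_nat i - of_nat l)"
    if "t \<in> T" "i \<le> k" for t i
  proof -
    \<comment> \<open>Within one chain \<open>\<epsilon>\<close> drops out of the differences; the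
      other two chains contribute full products.\<close>
    have "T \<times> {..k} - {(t, i)} = {t} \<times> ({..k} - {i}) \<union> (T - {t}) \<times> {..k}"
      using that by auto
    hence "(\<Prod>q\<in>T \<times> {..k} - {(t, i)}. x (t, i) - x q) =
        (\<Prod>q\<in>{t} \<times> ({..k} - {i}). x (t, i) - x q) * (\<Prod>q\<in>(T - {t}) \<times> {..k}. x (t, i) - x q)"
      by (simp only:) (rule prod.union_disjoint, auto simp: T_def)
    also have "(\<Prod>q\<in>{t} \<times> ({..k} - {i}). x (t, i) - x q) = (\<Prod>l\<in>{..k} - {i}. of_nat i - of_nat l)"
      by (subst prod.cartesian_product') (simp add: x_def)
    also have "(\<Prod>q\<in>(T - {t}) \<times> {..k}. x (t, i) - x q) =
        (\<Prod>u\<in>T - {t}. \<Prod>l\<le>k. of_int (t - u) * \<epsilon> + of_nat i - of_nat l)"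
      by (subst prod.cartesian_product', intro prod.cong) (auto simp: x_def algebra_simps)
    finally show ?thesis .
  qed
  define F where "F t = (\<Sum>i\<le>k. poly p (of_int t * \<epsilon> + of_nat i) /
      ((\<Prod>l\<in>{..k} - {i}. of_nat i - of_nat l) *
       (\<Prod>u\<in>T - {t}. \<Prod>l\<le>k. of_int (t - u) * \<epsilon> + of_nat i - of_nat l)))" for t
  have "(\<Sum>q\<in>T \<times> {..k}. poly p (x q) / (\<Prod>r\<in>T \<times> {..k} - {q}. x q - x r)) = 0"
    by (rule sum_poly_div_prod_diff_eq_0[OF _ inj]) (use deg in \<open>auto simp: T_def\<close>)
  also have "(\<Sum>q\<in>T \<times> {..k}. poly p (x q) / (\<Prod>r\<in>T \<times> {..k} - {q}. x q - x r)) =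
     (\<Sum>t\<in>T. \<Sum>i\<le>k. poly p (x (t, i)) / (\<Prod>r\<in>T \<times> {..k} - {(t, i)}. x (t, i) - x r))"
    by (rule sum.cartesian_product')
  also have "\<dots> = (\<Sum>t\<in>T. F t)"
    unfolding F_def by (intro sum.cong refl) (simp add: prods, simp add: x_def)
  also have "\<dots> = F 1 + F 0 + F (- 1)"
    by (simp add: T_def add_ac)
  finally have "F 1 + F 0 + F (- 1) = 0" .
  moreover have "T - {1} = {0, - 1}" "T - {0} = {- 1, 1}" "T - {- 1} = {0, 1}"
    by (auto simp: T_def)
  ultimately show ?thesis
    by (simp add: F_def mult.assoc add.commute[of _ \<epsilon>])
qed

section \<open>The quadratic relation\<close>

text \<open>The coefficient of \<open>(inverse z ^ 2) ^ k\<close> on the left-hand side of the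
  relation; the inner sums come from Cauchy products.\<close>

definition quad_coeff :: "complex \<Rightarrow> nat \<Rightarrow> complex" where
  "quad_coeff \<epsilon> k = 1/2 *
     (of_real pi ^ 3 / (sin (of_real pi * \<epsilon>) ^ 2 * cos (2 * of_real pi * \<epsilon>)) *
        (\<Sum>i\<le>k. gkz_coeff (1 + \<epsilon>) (1/2 - 2 * \<epsilon>) (1 + \<epsilon>) i * gkz_coeff (1 - \<epsilon>) (3/2 + 2 * \<epsilon>) (1 - \<epsilon>) (k - i))
      - 2 * of_real pi ^ 3 / sin (of_real pi * \<epsilon>) ^ 2 *
        (\<Sum>i\<le>k. gkz_coeff (1 - \<epsilon>) (1/2) (1 + \<epsilon>) i * gkz_coeff (1 + \<epsilon>) (3/2) (1 - \<epsilon>) (k - i))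
      + of_real pi ^ 3 / (sin (of_real pi * \<epsilon>) ^ 2 * cos (2 * of_real pi * \<epsilon>)) *
        (\<Sum>i\<le>k. gkz_coeff (1 - \<epsilon>) (1/2 + 2 * \<epsilon>) (1 - \<epsilon>) i * gkz_coeff (1 + \<epsilon>) (3/2 - 2 * \<epsilon>) (1 + \<epsilon>) (k - i)))"

text \<open>Each of the three convolutions runs over the residues on one chain, and
  \<open>2 * \<epsilon>\<close> not being an integer keeps all poles simple.\<close>

lemma quad_coeff_eq_0_generic:
  assumes k: "k > 0" and \<epsilon>: "2 * \<epsilon> \<notin> \<int>"
    and s: "sin (of_real pi * \<epsilon>) \<noteq> 0" and c: "cos (2 * of_real pi * \<epsilon>) \<noteq> 0"
  shows "quad_coeff \<epsilon> k = 0"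
proof -
  have \<epsilon>1: "\<epsilon> \<notin> \<int>" using \<epsilon> by (metis Ints_mult Ints_numeral)
  have \<epsilon>2: "2 * (- \<epsilon>) \<notin> \<int>" using \<epsilon> by (metis Ints_minus minus_minus mult_minus_right)
  have s2: "sin (of_real pi * (- \<epsilon>)) \<noteq> 0" and c2: "cos (2 * of_real pi * (- \<epsilon>)) \<noteq> 0"
    using s c by simp_all
  note shifted = gkz_coeff_product_shifted[OF _ k \<epsilon> s c]
  \<comment> \<open>The third family is the first one for \<open>- \<epsilon>\<close>, as the
    prefactor is even in \<open>\<epsilon>\<close>.\<close>
  have shifted': "of_real pi ^ 3 / (sin (of_real pi * \<epsilon>) ^ 2 * cos (2 * of_real pi * \<epsilon>)) *
           (gkz_coeff (1 - \<epsilon>) (1/2 + 2 * \<epsilon>) (1 - \<epsilon>) i * gkz_coeff (1 + \<epsilon>) (3/2 - 2 * \<epsilon>) (1 + \<epsilon>) (k - i)) =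
         poly (node_poly k) (- \<epsilon> + of_nat i) /
           ((\<Prod>l\<in>{..k} - {i}. of_nat i - of_nat l) * (\<Prod>l\<le>k. - \<epsilon> + of_nat i - of_nat l) *
            (\<Prod>l\<le>k. 2 * (- \<epsilon>) + of_nat i - of_nat l))" if "i \<le> k" for i
    using gkz_coeff_product_shifted[OF that k \<epsilon>2 s2 c2]
    by (simp only: mult_minus_right sin_minus cos_minus power2_minus diff_minus_eq_add add_uminus_conv_diff)
  note central = gkz_coeff_product_central[OF _ k s \<epsilon>1]
  have deg: "degree (node_poly k) \<le> 3 * k + 1"
    using degree_node_poly[OF k] by simp
  have *: "quad_coeff \<epsilon> k = 1/2 *
     ((\<Sum>i\<le>k. of_real pi ^ 3 / (sin (of_real pi * \<epsilon>) ^ 2 * cos (2 * of_real pi * \<epsilon>)) *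
        (gkz_coeff (1 + \<epsilon>) (1/2 - 2 * \<epsilon>) (1 + \<epsilon>) i * gkz_coeff (1 - \<epsilon>) (3/2 + 2 * \<epsilon>) (1 - \<epsilon>) (k - i)))
      + (\<Sum>i\<le>k. - (2 * of_real pi ^ 3 / sin (of_real pi * \<epsilon>) ^ 2 *
           (gkz_coeff (1 - \<epsilon>) (1/2) (1 + \<epsilon>) i * gkz_coeff (1 + \<epsilon>) (3/2) (1 - \<epsilon>) (k - i))))
      + (\<Sum>i\<le>k. of_real pi ^ 3 / (sin (of_real pi * \<epsilon>) ^ 2 * cos (2 * of_real pi * \<epsilon>)) *
        (gkz_coeff (1 - \<epsilon>) (1/2 + 2 * \<epsilon>) (1 - \<epsilon>) i * gkz_coeff (1 + \<epsilon>) (3/2 - 2 * \<epsilon>) (1 + \<epsilon>) (k - i))))"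
    unfolding quad_coeff_def sum_distrib_left sum_negf by (simp only: diff_conv_add_uminus)
  show ?thesis
    unfolding * mult_eq_0_iff
    by (rule disjI2, rule trans[OF _ sum_over_three_chains[OF deg \<epsilon>]],
        intro arg_cong2[where f = "(+)"] sum.cong refl shifted shifted' central) auto
qed

text \<open>With the binomial coefficients written as finite products, everything is continuous in
  \<open>\<epsilon>\<close>, and the denominators do not vanish.\<close>

lemma isCont_quad_coeff:
  assumes s: "sin (of_real pi * \<epsilon>) \<noteq> 0" and c: "cos (2 * of_real pi * \<epsilon>) \<noteq> 0"
  shows "isCont (\<lambda>\<epsilon>. quad_coeff \<epsilon> k) \<epsilon>"
  unfolding quad_coeff_def gkz_coeff_def gbinomial_prod_rev
  using s c by (intro continuous_intros) auto

text \<open>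
  At half-integers \<open>\<epsilon>\<close>, which the hypothesis allows, the chains of poles at \<open>\<epsilon> + l\<close> and
  \<open>- \<epsilon> + l\<close> overlap; these values are reached by continuity.
\<close>

lemma quad_coeff_eq_0:
  assumes k: "k > 0"
    and s: "sin (of_real pi * \<epsilon>) \<noteq> 0" and c: "cos (2 * of_real pi * \<epsilon>) \<noteq> 0"
  shows "quad_coeff \<epsilon> k = 0"
proof (cases "2 * \<epsilon> \<in> \<int>")
  case True
  then obtain n where n: "2 * \<epsilon> = of_int n" by (auto elim: Ints_cases)
  have "isCont (\<lambda>e. sin (of_real pi * e)) \<epsilon>" "isCont (\<lambda>e. cos (2 * of_real pi * e)) \<epsilon>"
    by (intro continuous_intros)+
  hence "\<forall>\<^sub>F e in at \<epsilon>. sin (of_real pi * e) \<noteq> 0" "\<forall>\<^sub>F e in at \<epsilon>. cos (2 * of_real pi * e) \<noteq> 0"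
    using s c by (auto simp: isCont_def intro: tendsto_imp_eventually_ne)
  \<comment> \<open>The radius \<open>1/2\<close> suffices because distinct integers
    \<open>2 * e\<close> and \<open>2 * \<epsilon>\<close> are at distance at least 1.\<close>
  moreover have "\<forall>\<^sub>F e in at \<epsilon>. 2 * e \<notin> \<int>"
    unfolding eventually_at
  proof (intro exI[of _ "1/2"] conjI ballI impI notI)
    fix e assume e: "e \<noteq> \<epsilon> \<and> dist e \<epsilon> < 1/2" and "2 * e \<in> \<int>"
    then obtain m where m: "2 * e = of_int m" by (auto elim: Ints_cases)
    have "of_int (m - n) = 2 * (e - \<epsilon>)"
      using m n by (simp add: algebra_simps)
    hence "norm (of_int (m - n) :: complex) = 2 * norm (e - \<epsilon>)"
      by (simp only: norm_mult norm_numeral)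
    also have "\<dots> < 1" using e by (simp add: dist_norm)
    finally have "real_of_int \<bar>m - n\<bar> < 1"
      by (simp only: norm_of_int of_int_abs)
    hence "m = n" by linarith
    hence "2 * e = 2 * \<epsilon>" using m n by simp
    thus False using e by simp
  qed simp
  ultimately have "\<forall>\<^sub>F e in at \<epsilon>. quad_coeff e k = 0"
    by eventually_elim (rule quad_coeff_eq_0_generic[OF k])
  hence "((\<lambda>e. quad_coeff e k) \<longlongrightarrow> 0) (at \<epsilon>)"
    by (rule tendsto_eventually)
  with isCont_quad_coeff[OF s c, of k] show ?thesis
    unfolding isCont_def by (intro tendsto_unique[of "at \<epsilon>"]) auto
qed (use quad_coeff_eq_0_generic[OF k _ s c] in auto)

lemma quad_coeff_0:
  assumes s: "sin (of_real pi * \<epsilon>) \<noteq> 0" and c: "cos (2 * of_real pi * \<epsilon>) \<noteq> 0"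
  shows "quad_coeff \<epsilon> 0 = 32 / (1 - 16 * \<epsilon> ^ 2)"
proof -
  define s' where "s' = sin (of_real pi * \<epsilon>)"
  define c' where "c' = cos (2 * of_real pi * \<epsilon>)"
  define P where "P = (of_real pi :: complex)"
  have s0: "s' \<noteq> 0" and c0: "c' \<noteq> 0" using s c by (simp_all only: s'_def c'_def not_False_eq_True)
  have P0: "P \<noteq> 0" by (simp add: P_def)
  have \<epsilon>0: "\<epsilon> \<noteq> 0" using s by auto
  \<comment> \<open>The cosine vanishes at \<open>e = - 1/4\<close>. Used for
    \<open>\<epsilon>\<close> and \<open>- \<epsilon>\<close>, this keeps the denominator of the
    result nonzero.\<close>
  have quarter: "1 + 4 * e \<noteq> 0" if "cos (2 * of_real pi * e) \<noteq> 0" for e :: complex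
  proof
    assume "1 + 4 * e = 0"
    hence "e = - 1 / 4" by (simp add: add_eq_0_iff field_simps)
    hence "2 * of_real pi * e = - of_real (pi / 2)" by simp
    hence "cos (2 * of_real pi * e) = of_real (cos (pi / 2))"
      by (simp only: cos_minus cos_of_real)
    thus False using that by simp
  qed
  have q1: "1 + 4 * \<epsilon> \<noteq> 0" and q2: "1 - 4 * \<epsilon> \<noteq> 0"
    using quarter[OF c] quarter[of "- \<epsilon>"] c by simp_all
  have G: "rGamma (1 + \<epsilon>) * rGamma (1 - \<epsilon>) = s' / (P * \<epsilon>)"
    using rGamma_reflection_shift[of \<epsilon> 0] \<epsilon>0 P0 by (simp add: s'_def P_def field_simps)
  \<comment> \<open>The step from \<open>1/2 + 2 * e\<close> up to \<open>3/2 + 2 * e\<close>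
    produces the denominator \<open>1 + 4 * e\<close>, that is, the pole at
    \<open>- 1/4\<close>.\<close>
  have H: "rGamma (1/2 - 2 * e) * rGamma (3/2 + 2 * e) = cos (2 * of_real pi * e) / P * (2 / (1 + 4 * e))"
    if "1 + 4 * e \<noteq> 0" for e
  proof -
    have "rGamma (3/2 + 2 * e) * (1 + 4 * e) = 2 * ((1/2 + 2 * e) * rGamma (1/2 + 2 * e + 1))"
      by (simp add: algebra_simps)
    hence "rGamma (3/2 + 2 * e) * (1 + 4 * e) = 2 * rGamma (1/2 + 2 * e)"
      by (simp only: rGamma_plus1)
    hence "rGamma (3/2 + 2 * e) = rGamma (1/2 + 2 * e) * (2 / (1 + 4 * e))"
      using that by (simp add: field_simps)
    thus ?thesis
      using rGamma_half_reflection[of e] by (simp add: P_def mult_ac)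
  qed
  have H1: "rGamma (1/2 - 2 * \<epsilon>) * rGamma (3/2 + 2 * \<epsilon>) = c' / P * (2 / (1 + 4 * \<epsilon>))"
    using H[OF q1] by (simp only: c'_def)
  have H2: "rGamma (1/2 + 2 * \<epsilon>) * rGamma (3/2 - 2 * \<epsilon>) = c' / P * (2 / (1 - 4 * \<epsilon>))"
    using H[of "- \<epsilon>"] q2 by (simp add: c'_def)
  have H3: "rGamma (1/2) * rGamma (3/2) = 2 / P"
    using H[of 0] by simp
  have "quad_coeff \<epsilon> 0 = 1/2 *
     (P ^ 3 / (s' ^ 2 * c') * ((rGamma (1/2 - 2 * \<epsilon>) * rGamma (3/2 + 2 * \<epsilon>)) * (rGamma (1 + \<epsilon>) * rGamma (1 - \<epsilon>)) ^ 2)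
      - 2 * P ^ 3 / s' ^ 2 * ((rGamma (1/2) * rGamma (3/2)) * (rGamma (1 + \<epsilon>) * rGamma (1 - \<epsilon>)) ^ 2)
      + P ^ 3 / (s' ^ 2 * c') * ((rGamma (1/2 + 2 * \<epsilon>) * rGamma (3/2 - 2 * \<epsilon>)) * (rGamma (1 + \<epsilon>) * rGamma (1 - \<epsilon>)) ^ 2))"
    by (simp add: quad_coeff_def gkz_coeff_def power2_eq_square mult_ac P_def s'_def c'_def)
  also have "\<dots> = 1/2 * (2 / (1 + 4 * \<epsilon>) / \<epsilon> ^ 2 - 4 / \<epsilon> ^ 2 + 2 / (1 - 4 * \<epsilon>) / \<epsilon> ^ 2)"
    unfolding G H1 H2 H3 using s0 c0 P0 \<epsilon>0
    by (simp add: power_divide power_mult_distrib power2_eq_square power3_eq_cube)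
  \<comment> \<open>The sum \<open>2 / (1 + 4 * \<epsilon>) + 2 / (1 - 4 * \<epsilon>) - 4\<close>
    has numerator \<open>64 * \<epsilon> ^ 2\<close>, which cancels the double pole at
    \<open>\<epsilon> = 0\<close>.\<close>
  also have "\<dots> = 32 / ((1 + 4 * \<epsilon>) * (1 - 4 * \<epsilon>))"
    using q1 q2 \<epsilon>0 by (simp add: divide_simps) (simp add: algebra_simps power2_eq_square)
  also have "(1 + 4 * \<epsilon>) * (1 - 4 * \<epsilon>) = 1 - 16 * \<epsilon> ^ 2"
    by (simp add: algebra_simps power2_eq_square)
  finally show ?thesis .
qed

lemma gkz_sum_product:
  assumes "(\<lambda>p. norm (gkz_term \<alpha> \<beta> \<gamma> z p)) summable_on UNIV"
    and "(\<lambda>p. norm (gkz_term \<alpha>' \<beta>' \<gamma>' z p)) summable_on UNIV"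
  shows "(\<lambda>k. (\<Sum>i\<le>k. gkz_coeff \<alpha> \<beta> \<gamma> i * gkz_coeff \<alpha>' \<beta>' \<gamma>' (k - i)) * (inverse z ^ 2) ^ k)
           sums (gkz_sum \<alpha> \<beta> \<gamma> z * gkz_sum \<alpha>' \<beta>' \<gamma>' z)"
proof -
  let ?w = "inverse z ^ 2"
  let ?a = "\<lambda>k. gkz_coeff \<alpha> \<beta> \<gamma> k * ?w ^ k" and ?b = "\<lambda>k. gkz_coeff \<alpha>' \<beta>' \<gamma>' k * ?w ^ k"
  have "(\<Sum>i\<le>k. ?a i * ?b (k - i)) = (\<Sum>i\<le>k. gkz_coeff \<alpha> \<beta> \<gamma> i * gkz_coeff \<alpha>' \<beta>' \<gamma>' (k - i)) * ?w ^ k" for k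
    unfolding sum_distrib_right
  proof (rule sum.cong[OF refl])
    fix i assume "i \<in> {..k}"
    hence "?w ^ k = ?w ^ i * ?w ^ (k - i)" by (simp flip: power_add)
    thus "?a i * ?b (k - i) = gkz_coeff \<alpha> \<beta> \<gamma> i * gkz_coeff \<alpha>' \<beta>' \<gamma>' (k - i) * ?w ^ k"
      by (simp only: mult_ac)
  qed
  thus ?thesis
    using Cauchy_product_sums[OF gkz_sum_power_series(1)[OF assms(1)] gkz_sum_power_series(1)[OF assms(2)]]
      sums_unique[OF gkz_sum_power_series(2)[OF assms(1)]] sums_unique[OF gkz_sum_power_series(2)[OF assms(2)]]
    by simp
qed

theorem mainTheorem10:
  fixes \<epsilon> :: complex
  assumes "sin (of_real pi * \<epsilon>) * cos (2 * of_real pi * \<epsilon>) \<noteq> 0"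
  shows "\<exists>R>0. \<forall>z l :: complex. norm z > R \<longrightarrow> exp l = z \<longrightarrow>
    gkz_all_summable \<epsilon> z \<and>
    1/2 * (of_real pi ^ 3 / (sin (of_real pi * \<epsilon>) ^ 2 * cos (2 * of_real pi * \<epsilon>))
              * phi345_pos \<epsilon> l z * phi345_neg \<epsilon> l z
           - 2 * of_real pi ^ 3 / sin (of_real pi * \<epsilon>) ^ 2
              * phi245_pos \<epsilon> l z * phi245_neg \<epsilon> l z
           + of_real pi ^ 3 / (sin (of_real pi * \<epsilon>) ^ 2 * cos (2 * of_real pi * \<epsilon>))
              * phi124_pos \<epsilon> l z * phi124_neg \<epsilon> l z)
      = 32 / (1 - 16 * \<epsilon> ^ 2)"
proof -
  have s: "sin (of_real pi * \<epsilon>) \<noteq> 0" and c: "cos (2 * of_real pi * \<epsilon>) \<noteq> 0"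
    using assms by auto
  \<comment> \<open>Since the sine vanishes at the integers, \<open>1 + \<epsilon>\<close> and
    \<open>1 - \<epsilon>\<close> avoid the poles of Gamma, as the convergence lemma
    requires.\<close>
  have "\<epsilon> \<notin> \<int>"
  proof
    assume "\<epsilon> \<in> \<int>"
    then obtain n where "\<epsilon> = of_int n" by (auto elim: Ints_cases)
    thus False using s by (auto simp: sin_eq_0 mult_ac)
  qed
  hence plus: "1 + \<epsilon> \<notin> \<int>\<^sub>\<le>\<^sub>0" and minus: "1 - \<epsilon> \<notin> \<int>\<^sub>\<le>\<^sub>0"
    using Ints_diff[of "1 + \<epsilon>" 1] Ints_diff[of 1 "1 - \<epsilon>"] nonpos_Ints_Int by auto
  have "\<forall>\<^sub>F z in at_infinity.
      (\<lambda>p. norm (gkz_term (1 + \<epsilon>) (1/2 - 2 * \<epsilon>) (1 + \<epsilon>) z p)) summable_on UNIV \<and>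
      (\<lambda>p. norm (gkz_term (1 - \<epsilon>) (1/2) (1 + \<epsilon>) z p)) summable_on UNIV \<and>
      (\<lambda>p. norm (gkz_term (1 - \<epsilon>) (1/2 + 2 * \<epsilon>) (1 - \<epsilon>) z p)) summable_on UNIV \<and>
      (\<lambda>p. norm (gkz_term (1 - \<epsilon>) (3/2 + 2 * \<epsilon>) (1 - \<epsilon>) z p)) summable_on UNIV \<and>
      (\<lambda>p. norm (gkz_term (1 + \<epsilon>) (3/2) (1 - \<epsilon>) z p)) summable_on UNIV \<and>
      (\<lambda>p. norm (gkz_term (1 + \<epsilon>) (3/2 - 2 * \<epsilon>) (1 + \<epsilon>) z p)) summable_on UNIV"
    by (intro eventually_conj gkz_term_summable plus minus)
  then obtain b where b: "\<And>z. norm z \<ge> b \<Longrightarrow>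
      (\<lambda>p. norm (gkz_term (1 + \<epsilon>) (1/2 - 2 * \<epsilon>) (1 + \<epsilon>) z p)) summable_on UNIV \<and>
      (\<lambda>p. norm (gkz_term (1 - \<epsilon>) (1/2) (1 + \<epsilon>) z p)) summable_on UNIV \<and>
      (\<lambda>p. norm (gkz_term (1 - \<epsilon>) (1/2 + 2 * \<epsilon>) (1 - \<epsilon>) z p)) summable_on UNIV \<and>
      (\<lambda>p. norm (gkz_term (1 - \<epsilon>) (3/2 + 2 * \<epsilon>) (1 - \<epsilon>) z p)) summable_on UNIV \<and>
      (\<lambda>p. norm (gkz_term (1 + \<epsilon>) (3/2) (1 - \<epsilon>) z p)) summable_on UNIV \<and>
      (\<lambda>p. norm (gkz_term (1 + \<epsilon>) (3/2 - 2 * \<epsilon>) (1 + \<epsilon>) z p)) summable_on UNIV"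
    unfolding eventually_at_infinity by blast
  show ?thesis
  proof (intro exI[of _ "max 1 b"] conjI allI impI)
    fix z l :: complex
    assume "norm z > max 1 b" and "exp l = z"
    hence S: "(\<lambda>p. norm (gkz_term (1 + \<epsilon>) (1/2 - 2 * \<epsilon>) (1 + \<epsilon>) z p)) summable_on UNIV"
      "(\<lambda>p. norm (gkz_term (1 - \<epsilon>) (1/2) (1 + \<epsilon>) z p)) summable_on UNIV"
      "(\<lambda>p. norm (gkz_term (1 - \<epsilon>) (1/2 + 2 * \<epsilon>) (1 - \<epsilon>) z p)) summable_on UNIV"
      "(\<lambda>p. norm (gkz_term (1 - \<epsilon>) (3/2 + 2 * \<epsilon>) (1 - \<epsilon>) z p)) summable_on UNIV"
      "(\<lambda>p. norm (gkz_term (1 + \<epsilon>) (3/2) (1 - \<epsilon>) z p)) summable_on UNIV"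
      "(\<lambda>p. norm (gkz_term (1 + \<epsilon>) (3/2 - 2 * \<epsilon>) (1 + \<epsilon>) z p)) summable_on UNIV"
      using b[of z] by auto
    show "gkz_all_summable \<epsilon> z"
      unfolding gkz_all_summable_def using S[THEN abs_summable_summable] by blast
    let ?c1 = "of_real pi ^ 3 / (sin (of_real pi * \<epsilon>) ^ 2 * cos (2 * of_real pi * \<epsilon>))"
    let ?c2 = "2 * of_real pi ^ 3 / sin (of_real pi * \<epsilon>) ^ 2"
    let ?S345 = "gkz_sum (1 + \<epsilon>) (1/2 - 2 * \<epsilon>) (1 + \<epsilon>) z * gkz_sum (1 - \<epsilon>) (3/2 + 2 * \<epsilon>) (1 - \<epsilon>) z"
    let ?S245 = "gkz_sum (1 - \<epsilon>) (1/2) (1 + \<epsilon>) z * gkz_sum (1 + \<epsilon>) (3/2) (1 - \<epsilon>) z"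
    let ?S124 = "gkz_sum (1 - \<epsilon>) (1/2 + 2 * \<epsilon>) (1 - \<epsilon>) z * gkz_sum (1 + \<epsilon>) (3/2 - 2 * \<epsilon>) (1 + \<epsilon>) z"
    let ?L = "1/2 * (?c1 * ?S345 - ?c2 * ?S245 + ?c1 * ?S124)"
    have L: "(\<lambda>k. quad_coeff \<epsilon> k * (inverse z ^ 2) ^ k) sums ?L"
    proof -
      note P = gkz_sum_product[OF S(1) S(4)] gkz_sum_product[OF S(2) S(5)] gkz_sum_product[OF S(3) S(6)]
      from sums_mult[OF sums_add[OF sums_diff[OF sums_mult[OF P(1), of ?c1] sums_mult[OF P(2), of ?c2]]
          sums_mult[OF P(3), of ?c1]], of "1/2"]
      show ?thesis
        unfolding quad_coeff_def
        by (simp only: mult.assoc[symmetric] left_diff_distrib[symmetric] distrib_right[symmetric])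
    qed
    \<comment> \<open>Only the constant term survives.\<close>
    have single: "(\<lambda>k. quad_coeff \<epsilon> k * (inverse z ^ 2) ^ k) = (\<lambda>k. if k = 0 then 32 / (1 - 16 * \<epsilon> ^ 2) else 0)"
      using quad_coeff_eq_0[OF _ s c] quad_coeff_0[OF s c] by (auto simp: fun_eq_iff)
    have "(\<lambda>k. if k = 0 then 32 / (1 - 16 * \<epsilon> ^ 2) else 0) sums (32 / (1 - 16 * \<epsilon> ^ 2))"
      using sums_single[of 0 "\<lambda>_. 32 / (1 - 16 * \<epsilon> ^ 2)"] by simp
    from sums_unique2[OF L[unfolded single] this]
    have result: "?L = 32 / (1 - 16 * \<epsilon> ^ 2)" .
    \<comment> \<open>The exponents in each product are opposite, so the choice of the logarithm
      \<open>l\<close> does not matter.\<close>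
    have cancel: "exp (u * l) * x * (exp (v * l) * y) = x * y" if "u + v = 0" for u v x y :: complex
    proof -
      have "exp (u * l) * exp (v * l) = 1"
        using that by (simp flip: exp_add distrib_right)
      moreover have "exp (u * l) * x * (exp (v * l) * y) = exp (u * l) * exp (v * l) * (x * y)"
        by (simp only: mult_ac)
      ultimately show ?thesis by simp
    qed
    have "phi345_pos \<epsilon> l z * phi345_neg \<epsilon> l z = ?S345"
      "phi245_pos \<epsilon> l z * phi245_neg \<epsilon> l z = ?S245"
      "phi124_pos \<epsilon> l z * phi124_neg \<epsilon> l z = ?S124"
      unfolding phi345_pos_def phi345_neg_def phi245_pos_def phi245_neg_def phi124_pos_def phi124_neg_def
      by (rule cancel, simp)+
    with result show "1/2 * (?c1 * phi345_pos \<epsilon> l z * phi345_neg \<epsilon> l z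
           - ?c2 * phi245_pos \<epsilon> l z * phi245_neg \<epsilon> l z
           + ?c1 * phi124_pos \<epsilon> l z * phi124_neg \<epsilon> l z) = 32 / (1 - 16 * \<epsilon> ^ 2)"
      by (simp only: mult.assoc)
  qed simp
qed

end
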